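(* Let $0<\alpha\le1$, $\gamma>0$, $\beta\ge\alpha\gamma$, $\theta>-\alpha\gamma$, and $\lambda\ge0$. Then for all $x\ge0$, $$x^{\beta+\theta-1}E^{\gamma+\theta/\alpha}_{\alpha,\beta+\theta}(-\lambda x^\alpha) = \frac{1}{\Gamma(\gamma+\theta/\alpha)}\int_0^\infty \{I_+^{\beta-\alpha\gamma} f_\alpha(\cdot\mid t)\}(x)\,t^{\gamma+\theta/\alpha-1}e^{-\lambda t}\,dt$$ $$= \frac{1}{\Gamma(\gamma+\theta/\alpha)}\int_0^\infty \{I_+^{\beta-\alpha\gamma} f_\alpha\}(x t^{-1/\alpha})\,t^{(\beta+\theta-1)/\alpha-1}e^{-\lambda t}\,dt .$$ In particular, if $\beta-\alpha\gamma=0$ this equals $\frac{1}{\Gamma(\gamma+\theta/\alpha)}\int_0^\infty f_\alpha(x t^{-1/\alpha})\,t^{(\beta+\theta-1)/\alpha-1}e^{-\lambda t}\,dt$, and if $\beta-\alpha\gamma=1-\alpha$ this equals $\frac{1}{\Gamma(\gamma+\theta/\alpha)}\,\frac{x}{\alpha}\int_0^\infty f_\alpha(x t^{-1/\alpha})\,t^{(\beta+\theta-2)/\alpha-1}e^{-\lambda t}\,dt$.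
   Context: The Prabhakar (three-parameter Mittag-Leffler) function is $E^\gamma_{\alpha,\beta}(z)=\frac{1}{\Gamma(\gamma)}\sum_{k=0}^\infty \frac{\Gamma(\gamma+k)}{k!\,\Gamma(\alpha k+\beta)}z^k$. For $0<\alpha<1$ and $t>0$, $f_\alpha(x\mid t)$ ($x\ge0$) denotes the density of the one-sided $\alpha$-stable distribution with scale $t$, defined by $\int_0^\infty e^{-sx} f_\alpha(x\mid t)\,dx = e^{-t s^\alpha}$; $f_\alpha(x):=f_\alpha(x\mid 1)$, and $f_\alpha(x\mid t)=f_\alpha(xt^{-1/\alpha})t^{-1/\alpha}$. For $\alpha=1$, $f_1(x\mid t):=\delta(x-t)$, with identities understood in the sense of measures. For $\nu>0$, $\{I_+^\nu f\}(x)=\frac{1}{\Gamma(\nu)}\int_0^x (x-u)^{\nu-1} f(u)\,du$ (Riemann–Liouville fractional integral, Laplace transform $s^{-\nu}\widetilde f(s)$), and $\{I_+^0 f\}:=f$.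
   Formalization: The identities are proved for x>0 rather than x≥0: at x=0 the left side is undefined when β+θ<1, and when β+θ=1 it can equal 1 while the right side is 0 (e.g. α=1/2, γ=β=1, θ=λ=0); for β+θ>1 both sides at x=0 are trivially 0. *)

theory Defs
  imports "HOL-Analysis.Analysis" "HOL-Probability.Probability"
begin

definition Prabhakar :: "real \<Rightarrow> real \<Rightarrow> real \<Rightarrow> real \<Rightarrow> real" where
  "Prabhakar \<alpha> \<beta> \<gamma> z =
     (\<Sum>k. Gamma (\<gamma> + real k) / (fact k * Gamma (\<alpha> * real k + \<beta>)) * z ^ k) / Gamma \<gamma>"

text \<open>Density f_alpha(x | t) (0 < alpha < 1) of the one-sided alpha-stable law with scale t,
  characterised by its Laplace transform exp(-t s^alpha).  It is taken as the (unique)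
  nonnegative function vanishing on (-inf,0] and continuous on (0,inf) with that Laplace
  transform.\<close>
definition stable_pdf :: "real \<Rightarrow> real \<Rightarrow> real \<Rightarrow> real" where
  "stable_pdf \<alpha> t = (THE f. (\<forall>x. 0 \<le> f x) \<and> (\<forall>x\<le>0. f x = 0) \<and> continuous_on {0<..} f \<and>
      (\<forall>s>0. ((\<lambda>x. exp (- (s * x)) * f x) has_integral exp (- (t * s powr \<alpha>))) {0..}))"

text \<open>The one-sided stable law with scale t as a measure: density f_alpha(.|t) for alpha < 1,
  and the Dirac measure at t for alpha = 1 (f_1(x|t) := delta(x-t)).\<close>
definition stable_measure :: "real \<Rightarrow> real \<Rightarrow> real measure" where
  "stable_measure \<alpha> t = (if \<alpha> = 1 then return borel t else density lborel (stable_pdf \<alpha> t))"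

definition RL_int :: "real \<Rightarrow> (real \<Rightarrow> real) \<Rightarrow> real \<Rightarrow> real" where
  "RL_int \<nu> f x = (if \<nu> = 0 then f x
     else (LINT u:{0..x}|lborel. (x - u) powr (\<nu> - 1) * f u) / Gamma \<nu>)"

text \<open>Riemann--Liouville fractional integral (order nu > 0) of a measure M on [0,inf),
  evaluated at x: (1/Gamma nu) * integral over u < x of (x-u)^(nu-1) dM(u).
  Used for f_1(.|t) = delta(. - t).\<close>
definition RL_meas :: "real \<Rightarrow> real measure \<Rightarrow> real \<Rightarrow> real" where
  "RL_meas \<nu> M x = (\<integral>u. indicator {..<x} u * (x - u) powr (\<nu> - 1) \<partial>M) / Gamma \<nu>"

text \<open>Test functions for identities in the sense of measures on (0,inf):
  continuous functions with compact support in (0,inf).\<close>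
definition test_fun :: "(real \<Rightarrow> real) \<Rightarrow> bool" where
  "test_fun \<phi> \<longleftrightarrow> continuous_on UNIV \<phi> \<and>
     (\<exists>a b. 0 < a \<and> a \<le> b \<and> (\<forall>x. x \<notin> {a..b} \<longrightarrow> \<phi> x = 0))"

end

theory Submission
  imports Defs "HOL-Complex_Analysis.Complex_Analysis" "HOL-Real_Asymp.Real_Asymp"
begin

text \<open>
  Put \<open>c = \<gamma> + \<theta> / \<alpha>\<close>, \<open>b = \<beta> + \<theta>\<close> and \<open>d = \<beta> - \<alpha> \<gamma>\<close>, so that \<open>b = \<alpha> c + d\<close>. If \<open>g \<ge> 0\<close> has the
  Laplace transform \<open>s^(-d) exp(-s^\<alpha>)\<close>, then integrating the latter against \<open>s^(B-1)\<close> and exchanging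
  the order of integration gives the moments \<open>\<integral> y^(-B) g(y) dy = \<Gamma>((B - d) / \<alpha>) / (\<alpha> \<Gamma>(B))\<close>.
  Substitute \<open>t = (x/y)^\<alpha>\<close> and expand \<open>exp(-\<lambda> t)\<close> in the mixture
  \<open>\<integral> g(x t^(-1/\<alpha>)) t^((b-1)/\<alpha> - 1) exp(-\<lambda> t) dt\<close>: the moments with \<open>B = \<alpha> k + b\<close> produce exactly the
  coefficients of the Prabhakar series. All pointwise identities come from choices of \<open>g\<close>: a fractional
  integral of the stable density \<open>f\<close>, the function \<open>y f(y) / \<alpha>\<close>, or a shifted power.

  The stable density has to be shown to exist. It is the Fourier integral of \<open>exp(-(i u)^\<alpha>)\<close>; its
  Laplace transform follows from Cauchy's formula in the right half-plane. Nonnegativity and uniqueness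
  both follow from Hausdorff's argument: if the Laplace transform of \<open>h\<close> is completely monotone, its
  iterated differences show that \<open>exp(-x) h(x) dx\<close> pairs nonnegatively with all Bernstein polynomials
  in \<open>exp(-x)\<close>.
\<close>

subsection \<open>Complete monotonicity\<close>

text \<open>Complete monotonicity up to order \<open>n\<close>. The witness \<open>h\<close> is the
  negated derivative, so every level of the recursion asks for nonnegativity only and closure
  properties follow by plain induction.\<close>

primrec cmono :: "nat \<Rightarrow> (real \<Rightarrow> real) \<Rightarrow> bool" where
  "cmono 0 g \<longleftrightarrow> (\<forall>s>0. 0 \<le> g s)"
| "cmono (Suc n) g \<longleftrightarrow> (\<forall>s>0. 0 \<le> g s) \<and>
     (\<exists>h. (\<forall>s>0. (g has_real_derivative - h s) (at s)) \<and> cmono n h)"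

lemma cmono_nonneg: "cmono n g \<Longrightarrow> s > 0 \<Longrightarrow> 0 \<le> g s"
  by (cases n) auto

lemma cmono_SucI:
  assumes "\<And>s. s > 0 \<Longrightarrow> 0 \<le> g s" "\<And>s. s > 0 \<Longrightarrow> (g has_real_derivative - h s) (at s)" "cmono n h"
  shows "cmono (Suc n) g"
  using assms by auto

lemma cmono_SucE:
  assumes "cmono (Suc n) g"
  obtains h where "\<And>s. s > 0 \<Longrightarrow> (g has_real_derivative - h s) (at s)" "cmono n h"
  using assms by auto

lemma cmono_Suc_imp: "cmono (Suc n) g \<Longrightarrow> cmono n g"
proof (induction n arbitrary: g)
  case (Suc n)
  from Suc.prems obtain h where h: "\<And>s. s > 0 \<Longrightarrow> (g has_real_derivative - h s) (at s)" "cmono (Suc n) h"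
    by (rule cmono_SucE) blast
  show ?case
    using cmono_SucI[of g h n] Suc.IH[OF h(2)] h(1) cmono_nonneg[OF Suc.prems] by blast
qed auto

lemma cmono_cong:
  assumes "cmono n g" "\<And>s. s > 0 \<Longrightarrow> g s = g' s"
  shows "cmono n g'"
proof (cases n)
  case 0
  then show ?thesis using assms by auto
next
  case (Suc m)
  with assms obtain h where h: "\<And>s. s > 0 \<Longrightarrow> (g has_real_derivative - h s) (at s)" "cmono m h"
    by (auto elim: cmono_SucE)
  have "(g' has_real_derivative - h s) (at s)" if "s > 0" for s
    by (rule has_field_derivative_transform_within_open[OF h(1)[OF that], of "{0<..}"])
       (use that assms(2) in auto)
  then show ?thesis
    using cmono_SucI[of g' h m] h cmono_nonneg[OF assms(1)] assms(2) Suc by metis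
qed

lemma cmono_add: "cmono n g \<Longrightarrow> cmono n h \<Longrightarrow> cmono n (\<lambda>s. g s + h s)"
proof (induction n arbitrary: g h)
  case (Suc n)
  obtain g' where g': "\<And>s. s > 0 \<Longrightarrow> (g has_real_derivative - g' s) (at s)" "cmono n g'"
    using Suc.prems(1) by (rule cmono_SucE) blast
  obtain h' where h': "\<And>s. s > 0 \<Longrightarrow> (h has_real_derivative - h' s) (at s)" "cmono n h'"
    using Suc.prems(2) by (rule cmono_SucE) blast
  show ?case
  proof (rule cmono_SucI[where h = "\<lambda>s. g' s + h' s"])
    show "((\<lambda>s. g s + h s) has_real_derivative - (g' s + h' s)) (at s)" if "s > 0" for s
      using DERIV_add[OF g'(1)[OF that] h'(1)[OF that]] by simp
  qed (use Suc cmono_nonneg g' h' in \<open>auto simp: add_nonneg_nonneg\<close>)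
qed auto

text \<open>The negated derivative of a product is \<open>g' h + g h'\<close>. Both summands are
  products of functions of order \<open>n\<close>, to which the induction hypothesis
  applies.\<close>

lemma cmono_mult: "cmono n g \<Longrightarrow> cmono n h \<Longrightarrow> cmono n (\<lambda>s. g s * h s)"
proof (induction n arbitrary: g h)
  case (Suc n)
  obtain g' where g': "\<And>s. s > 0 \<Longrightarrow> (g has_real_derivative - g' s) (at s)" "cmono n g'"
    using Suc.prems(1) by (rule cmono_SucE) blast
  obtain h' where h': "\<And>s. s > 0 \<Longrightarrow> (h has_real_derivative - h' s) (at s)" "cmono n h'"
    using Suc.prems(2) by (rule cmono_SucE) blast
  show ?case
  proof (rule cmono_SucI[where h = "\<lambda>s. g' s * h s + g s * h' s"])
    show "((\<lambda>s. g s * h s) has_real_derivative - (g' s * h s + g s * h' s)) (at s)" if "s > 0" for s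
      using DERIV_mult[OF g'(1)[OF that] h'(1)[OF that]] by (simp add: algebra_simps)
    show "cmono n (\<lambda>s. g' s * h s + g s * h' s)"
      by (intro cmono_add Suc.IH g' h' cmono_Suc_imp[OF Suc.prems(1)] cmono_Suc_imp[OF Suc.prems(2)])
    show "0 \<le> g s * h s" if "s > 0" for s
      using cmono_nonneg[OF Suc.prems(1) that] cmono_nonneg[OF Suc.prems(2) that] by simp
  qed
qed auto

lemma cmono_zero: "cmono n (\<lambda>_. 0)"
  by (induction n) (auto intro!: exI[of _ "\<lambda>_. 0"])

text \<open>The factor \<open>c\<close> is carried along so that the family is closed under negated
  differentiation: \<open>- e\<close> is absorbed into the constant and stays nonnegative.\<close>

lemma cmono_powr: "0 \<le> c \<Longrightarrow> e \<le> 0 \<Longrightarrow> cmono n (\<lambda>s. c * s powr e)"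
proof (induction n arbitrary: c e)
  case (Suc n)
  show ?case
  proof (rule cmono_SucI[where h = "\<lambda>s. (c * (- e)) * s powr (e - 1)"])
    show "((\<lambda>s. c * s powr e) has_real_derivative - (c * - e * s powr (e - 1))) (at s)" if "s > 0" for s
      using that by (auto intro!: derivative_eq_intros simp: powr_diff)
    show "cmono n (\<lambda>s. c * - e * s powr (e - 1))"
      by (rule Suc.IH) (use Suc.prems in \<open>auto simp: mult_nonneg_nonpos\<close>)
  qed (use Suc in auto)
qed auto

text \<open>The negated derivative is the function itself times
  \<open>t * \<alpha> * s powr (\<alpha> - 1)\<close>, and that factor is completely monotone
  because \<open>\<alpha> \<le> 1\<close>.\<close>

lemma cmono_exp_powr:
  assumes "0 < \<alpha>" "\<alpha> \<le> 1" "0 \<le> t"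
  shows "cmono n (\<lambda>s. exp (- (t * s powr \<alpha>)))"
proof (induction n)
  case (Suc n)
  show ?case
  proof (rule cmono_SucI[where h = "\<lambda>s. (t * \<alpha>) * s powr (\<alpha> - 1) * exp (- (t * s powr \<alpha>))"])
    show "((\<lambda>s. exp (- (t * s powr \<alpha>))) has_real_derivative
        - ((t * \<alpha>) * s powr (\<alpha> - 1) * exp (- (t * s powr \<alpha>)))) (at s)" if "s > 0" for s
      using that by (auto intro!: derivative_eq_intros simp: powr_diff)
    show "cmono n (\<lambda>s. (t * \<alpha>) * s powr (\<alpha> - 1) * exp (- (t * s powr \<alpha>)))"
      by (intro cmono_mult cmono_powr Suc) (use assms in auto)
  qed auto
qed auto

lemma cmono_decreasing:
  assumes "cmono (Suc n) g" "0 < s" "s \<le> t"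
  shows "g t \<le> g s"
proof (rule DERIV_nonpos_imp_nonincreasing[OF \<open>s \<le> t\<close>])
  obtain h where h: "\<And>s. s > 0 \<Longrightarrow> (g has_real_derivative - h s) (at s)" "cmono n h"
    using assms(1) by (rule cmono_SucE) blast
  show "\<exists>y. (g has_real_derivative y) (at x) \<and> y \<le> 0" if "s \<le> x" for x
    using h(1)[of x] cmono_nonneg[OF h(2), of x] assms(2) that by (intro exI[of _ "- h x"]) auto
qed

text \<open>One order is lost because nonnegativity of a difference rests on the sign of the first
  derivative.\<close>

lemma cmono_diff:
  assumes "cmono (Suc n) g"
  shows "cmono n (\<lambda>s. g s - g (s + 1))"
  using assms
proof (induction n arbitrary: g)
  case (Suc n)
  obtain h where h: "\<And>s. s > 0 \<Longrightarrow> (g has_real_derivative - h s) (at s)" "cmono (Suc n) h"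
    using Suc.prems by (rule cmono_SucE) blast
  have dec: "g (s + 1) \<le> g s" if "s > 0" for s
    using cmono_decreasing[OF Suc.prems that, of "s + 1"] by simp
  show ?case
  proof (rule cmono_SucI[where h = "\<lambda>s. h s - h (s + 1)"])
    show "((\<lambda>s. g s - g (s + 1)) has_real_derivative - (h s - h (s + 1))) (at s)" if "s > 0" for s
    proof -
      have "((\<lambda>s. g (s + 1)) has_real_derivative - h (s + 1)) (at s)"
        using h(1)[of "s + 1"] that by (simp add: DERIV_shift)
      from DERIV_diff[OF h(1)[OF that] this] show ?thesis by simp
    qed
  qed (use dec Suc.IH[OF h(2)] in auto)
next
  case 0
  then show ?case using cmono_decreasing[of 0 g] by fastforce
qed

subsection \<open>Positivity and uniqueness for Laplace transforms\<close>

lemma set_lebesgue_integral_sum: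
  fixes f :: "'i \<Rightarrow> 'a \<Rightarrow> 'b :: {banach, second_countable_topology}"
  assumes "\<And>i. i \<in> I \<Longrightarrow> set_integrable M A (f i)"
  shows "(LINT x:A|M. (\<Sum>i\<in>I. f i x)) = (\<Sum>i\<in>I. LINT x:A|M. f i x)"
  using assms unfolding set_lebesgue_integral_def set_integrable_def
  by (simp add: scaleR_sum_right Bochner_Integration.integral_sum)

text \<open>Multiplying \<open>h\<close> by \<open>1 - exp (- x)\<close> replaces its Laplace
  transform \<open>g s\<close> by \<open>g s - g (s + 1)\<close>, which is again completely
  monotone. Induction on \<open>m\<close>, generalised over \<open>h\<close>, iterates this.\<close>

lemma laplace_diff_nonneg:
  fixes h :: "real \<Rightarrow> real"
  assumes int: "\<And>s. s > 0 \<Longrightarrow> set_integrable lborel {0<..} (\<lambda>x. exp (- (s * x)) * h x)"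
    and cm: "\<And>n. cmono n (\<lambda>s. LINT x:{0<..}|lborel. exp (- (s * x)) * h x)"
    and "s > 0"
  shows "0 \<le> (LINT x:{0<..}|lborel. exp (- (s * x)) * (1 - exp (- x)) ^ m * h x)"
  using int cm
proof (induction m arbitrary: h)
  case 0
  from cmono_nonneg[OF 0(2)[of 0] \<open>s > 0\<close>] show ?case by simp
next
  case (Suc m)
  let ?h = "\<lambda>x. (1 - exp (- x)) * h x"
  have eq: "exp (- (s * x)) * ?h x = exp (- (s * x)) * h x - exp (- ((s + 1) * x)) * h x" for s x
    by (simp add: algebra_simps exp_add exp_minus exp_diff divide_inverse)
  have i: "set_integrable lborel {0<..} (\<lambda>x. exp (- (s * x)) * ?h x)" if "s > 0" for s
    unfolding eq using that by (intro set_integral_diff Suc.prems) auto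
  have "cmono n (\<lambda>s. LINT x:{0<..}|lborel. exp (- (s * x)) * ?h x)" for n
    by (rule cmono_cong[OF cmono_diff[OF Suc.prems(2)[of "Suc n"]]])
       (auto simp: eq set_integral_diff Suc.prems(1))
  from Suc.IH[OF i this] show ?case by (simp add: mult_ac)
qed

text \<open>The functional \<open>G\<close> below is nonnegative on the Bernstein polynomials of
  nonnegative functions, hence by uniform approximation on all nonnegative continuous functions on
  the unit interval. If \<open>h\<close> were negative at \<open>x0\<close>, a bump near
  \<open>exp (- x0)\<close> would contradict this.\<close>

lemma laplace_cmono_imp_nonneg:
  fixes h :: "real \<Rightarrow> real"
  assumes int: "\<And>s. s > 0 \<Longrightarrow> set_integrable lborel {0<..} (\<lambda>x. exp (- (s * x)) * h x)"
    and cm: "\<And>n. cmono n (\<lambda>s. LINT x:{0<..}|lborel. exp (- (s * x)) * h x)"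
    and cont: "continuous_on {0<..} h" and "x0 > 0"
  shows "0 \<le> h x0"
proof (rule ccontr)
  assume neg: "\<not> 0 \<le> h x0"
  \<comment> \<open>The variable \<open>exp (- x)\<close> maps the half-line into the unit interval.
    The weight \<open>exp (- x)\<close> makes \<open>h\<close> integrable, by the hypothesis at
    \<open>s = 1\<close>.\<close>
  define G where "G \<phi> = (LINT x:{0<..}|lborel. exp (- x) * h x * \<phi> (exp (- x)))" for \<phi> :: "real \<Rightarrow> real"
  have int1: "set_integrable lborel {0<..} (\<lambda>x. exp (- x) * h x)"
    using int[of 1] by simp
  have intG: "set_integrable lborel {0<..} (\<lambda>x. exp (- x) * h x * \<phi> (exp (- x)))"
    if c: "continuous_on {0..1} \<phi>" for \<phi>
  proof -
    have "bounded (\<phi> ` {0..1})" by (intro compact_imp_bounded compact_continuous_image c) auto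
    then obtain B where B: "\<And>y. y \<in> {0..1} \<Longrightarrow> \<bar>\<phi> y\<bar> \<le> B"
      unfolding bounded_iff by fastforce
    have meas: "set_borel_measurable borel {0<..} (\<lambda>x::real. \<phi> (exp (- x)))"
    proof -
      have "continuous_on {0<..} (\<lambda>x::real. \<phi> (exp (- x)))"
        by (rule continuous_on_compose2[OF c]) (auto intro!: continuous_intros)
      then show ?thesis unfolding set_borel_measurable_def by (intro borel_measurable_continuous_on_indicator) auto
    qed
    have "set_integrable lborel {0<..} (\<lambda>x. B * \<bar>exp (- x) * h x\<bar>)"
      using int1 by (intro set_integrable_mult_right set_integrable_abs)
    then show ?thesis
    proof (rule set_integrable_bound)
      have "(\<lambda>x. (indicator {0<..} x *\<^sub>R (exp (- x) * h x)) * (indicator {0<..} x *\<^sub>R \<phi> (exp (- x)))) \<in> borel_measurable lborel"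
        using int1 meas unfolding set_integrable_def set_borel_measurable_def by (intro borel_measurable_times) auto
      also have "(\<lambda>x. (indicator {0<..} x *\<^sub>R (exp (- x) * h x)) * (indicator {0<..} x *\<^sub>R \<phi> (exp (- x))))
         = (\<lambda>x. indicator {0<..} x *\<^sub>R (exp (- x) * h x * \<phi> (exp (- x))))"
        by (auto simp: indicator_def)
      finally show "set_borel_measurable lborel {0<..} (\<lambda>x. exp (- x) * h x * \<phi> (exp (- x)))"
        unfolding set_borel_measurable_def .
      show "AE x in lborel. x \<in> {0<..} \<longrightarrow>
        norm (exp (- x) * h x * \<phi> (exp (- x))) \<le> norm (B * \<bar>exp (- x) * h x\<bar>)"
      proof (intro AE_I2 impI)
        fix x :: real assume "x \<in> {0<..}"
        then have "\<bar>\<phi> (exp (- x))\<bar> \<le> B" by (intro B) auto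
        moreover from this have "\<bar>exp (- x) * h x\<bar> * \<bar>\<phi> (exp (- x))\<bar> \<le> \<bar>exp (- x) * h x\<bar> * B" "0 \<le> B"
          by (auto intro: mult_left_mono)
        ultimately show "norm (exp (- x) * h x * \<phi> (exp (- x))) \<le> norm (B * \<bar>exp (- x) * h x\<bar>)"
          by (simp add: abs_mult mult_ac)
      qed
    qed
  qed
  have Bern: "0 \<le> G (\<lambda>y. \<Sum>k\<le>n. \<phi> (real k / real n) * Bernstein n k y)"
    if nn: "\<And>y. y \<in> {0..1} \<Longrightarrow> 0 \<le> \<phi> y" for \<phi> :: "real \<Rightarrow> real" and n
  proof -
    have "G (\<lambda>y. \<Sum>k\<le>n. \<phi> (real k / real n) * Bernstein n k y)
      = (LINT x:{0<..}|lborel. (\<Sum>k\<le>n. \<phi> (real k / real n) * (exp (- x) * h x * Bernstein n k (exp (- x)))))"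
      unfolding G_def by (simp add: sum_distrib_left mult_ac)
    also have "\<dots> = (\<Sum>k\<le>n. \<phi> (real k / real n) * (LINT x:{0<..}|lborel. exp (- x) * h x * Bernstein n k (exp (- x))))"
      by (subst set_lebesgue_integral_sum)
         (auto intro!: set_integrable_mult_right intG continuous_intros simp: Bernstein_def)
    also have "\<dots> \<ge> 0"
    proof (intro sum_nonneg mult_nonneg_nonneg)
      fix k assume k: "k \<in> {..n}"
      \<comment> \<open>For \<open>n = 0\<close> the quotient is 0 by convention, so the node still
        lies in \<open>{0..1}\<close>.\<close>
      show "0 \<le> \<phi> (real k / real n)" using k by (intro nn) (auto simp: divide_le_eq_1)
      \<comment> \<open>This is the integrand of \<open>laplace_diff_nonneg\<close> with exponent
        \<open>k + 1\<close> and \<open>m = n - k\<close>. The weight \<open>exp (- x)\<close> keeps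
        the exponent positive even for \<open>k = 0\<close>.\<close>
      have Beq: "exp (- x) * h x * Bernstein n k (exp (- x)) =
          real (n choose k) * (exp (- ((real k + 1) * x)) * (1 - exp (- x)) ^ (n - k) * h x)" for x
        by (simp add: Bernstein_def exp_of_nat_mult[symmetric] algebra_simps exp_add[symmetric])
      show "0 \<le> (LINT x:{0<..}|lborel. exp (- x) * h x * Bernstein n k (exp (- x)))"
        unfolding Beq set_integral_mult_right
        by (intro mult_nonneg_nonneg laplace_diff_nonneg int cm) auto
    qed
    finally show ?thesis .
  qed
  define C where "C = (LINT x:{0<..}|lborel. \<bar>exp (- x) * h x\<bar>)"
  have C: "0 \<le> C" unfolding C_def set_lebesgue_integral_def by (intro integral_nonneg_AE) auto
  have G_nonneg: "0 \<le> G \<phi>"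
    if nn: "\<And>y. y \<in> {0..1} \<Longrightarrow> 0 \<le> \<phi> y" and c: "continuous_on {0..1} \<phi>" for \<phi>
  proof (rule field_le_epsilon)
    fix e :: real assume "e > 0"
    \<comment> \<open>Adding 1 keeps the denominator positive when \<open>C = 0\<close>, and still
      \<open>e' * C \<le> e\<close>.\<close>
    define e' where "e' = e / (C + 1)"
    have "e' > 0" using \<open>e > 0\<close> C by (simp add: e'_def)
    from Bernstein_Weierstrass[OF c this] obtain N where
      N: "\<And>y. y \<in> {0..1} \<Longrightarrow> \<bar>\<phi> y - (\<Sum>k\<le>N. \<phi> (real k / real N) * Bernstein N k y)\<bar> < e'"
      by blast
    define \<psi> where "\<psi> = (\<lambda>y. \<Sum>k\<le>N. \<phi> (real k / real N) * Bernstein N k y)"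
    have c': "continuous_on {0..1} \<psi>" unfolding \<psi>_def Bernstein_def by (intro continuous_intros)
    have "G \<psi> - G \<phi> = (LINT x:{0<..}|lborel. exp (- x) * h x * \<psi> (exp (- x)) - exp (- x) * h x * \<phi> (exp (- x)))"
      unfolding G_def by (rule set_integral_diff(2)[symmetric]) (intro intG c c')+
    also have "\<dots> \<le> (LINT x:{0<..}|lborel. e' * \<bar>exp (- x) * h x\<bar>)"
    proof (rule set_integral_mono)
      show "set_integrable lborel {0<..} (\<lambda>x. exp (- x) * h x * \<psi> (exp (- x)) - exp (- x) * h x * \<phi> (exp (- x)))"
        by (intro set_integral_diff intG c c')
      show "set_integrable lborel {0<..} (\<lambda>x. e' * \<bar>exp (- x) * h x\<bar>)"
        using int1 by (intro set_integrable_mult_right set_integrable_abs)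
      fix x :: real assume "x \<in> {0<..}"
      then have "\<bar>\<psi> (exp (- x)) - \<phi> (exp (- x))\<bar> \<le> e'"
        using N[of "exp (- x)"] unfolding \<psi>_def by (auto simp: abs_minus_commute)
      then have "\<bar>exp (- x) * h x\<bar> * \<bar>\<psi> (exp (- x)) - \<phi> (exp (- x))\<bar> \<le> \<bar>exp (- x) * h x\<bar> * e'"
        by (intro mult_left_mono) auto
      then have "\<bar>(exp (- x) * h x) * (\<psi> (exp (- x)) - \<phi> (exp (- x)))\<bar> \<le> \<bar>exp (- x) * h x\<bar> * e'"
        by (simp only: abs_mult)
      then show "exp (- x) * h x * \<psi> (exp (- x)) - exp (- x) * h x * \<phi> (exp (- x)) \<le> e' * \<bar>exp (- x) * h x\<bar>"
        by (simp only: right_diff_distrib mult.commute[of e'])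
    qed
    also have "\<dots> = e' * C" by (simp add: C_def)
    also have "\<dots> \<le> e" using C \<open>e > 0\<close> by (simp add: e'_def field_simps)
    finally have "G \<psi> \<le> G \<phi> + e" by simp
    moreover have "0 \<le> G \<psi>" unfolding \<psi>_def by (rule Bern[OF nn])
    ultimately show "0 \<le> G \<phi> + e" by simp
  qed
  obtain \<epsilon> where \<epsilon>: "\<epsilon> > 0" "\<And>x. \<bar>x - x0\<bar> < \<epsilon> \<Longrightarrow> x > 0 \<and> h x < 0"
  proof -
    have "isCont h x0" using cont \<open>x0 > 0\<close> by (simp add: continuous_on_eq_continuous_at)
    then have "\<forall>\<^sub>F x in at x0. h x < 0"
      using neg by (intro order_tendstoD(2)[of h "h x0"]) (auto simp: isCont_def)
    then have "\<forall>\<^sub>F x in nhds x0. h x < 0 \<and> x > 0"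
      using neg \<open>x0 > 0\<close> by (intro eventually_conj eventually_nhds_in_open[of "{0<..}" x0, simplified]) (auto simp: eventually_nhds_conv_at)
    then show ?thesis using that unfolding eventually_nhds_metric dist_real_def by blast
  qed
  \<comment> \<open>A tent function in \<open>y\<close>, positive exactly when
    \<open>y = exp (- x)\<close> with \<open>x\<close> within \<open>\<epsilon>\<close> of
    \<open>x0\<close>.\<close>
  define \<phi> where "\<phi> = (\<lambda>y. max 0 (min (y - exp (- (x0 + \<epsilon>))) (exp (- (x0 - \<epsilon>)) - y)))"
  have c: "continuous_on {0..1} \<phi>" unfolding \<phi>_def by (intro continuous_intros)
  have pos: "0 < \<phi> (exp (- x)) \<longleftrightarrow> \<bar>x - x0\<bar> < \<epsilon>" for x
    unfolding \<phi>_def by (simp add: less_max_iff_disj) arith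
  have nn: "0 \<le> \<phi> y" for y unfolding \<phi>_def by auto
  have le: "exp (- x) * h x * \<phi> (exp (- x)) \<le> 0" for x
    using pos[of x] nn[of "exp (- x)"] \<epsilon>(2)[of x] by (cases "\<phi> (exp (- x)) = 0") (auto simp: mult_le_0_iff)
  \<comment> \<open>The integrand is nowhere positive because \<open>h\<close> is negative on the
    support of the tent, while \<open>G \<phi>\<close> is nonnegative. So the integral is zero and
    the integrand vanishes almost everywhere, although it is strictly negative on an
    interval.\<close>
  have "G \<phi> = 0"
  proof (rule antisym)
    have "0 \<le> (\<integral>x. - (indicator {0<..} x *\<^sub>R (exp (- x) * h x * \<phi> (exp (- x)))) \<partial>lborel)"
      by (intro integral_nonneg_AE AE_I2) (use le in \<open>auto simp: indicator_def\<close>)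
    then show "G \<phi> \<le> 0" unfolding G_def set_lebesgue_integral_def by simp
  qed (intro G_nonneg c nn)
  then have "(\<integral>x. - (indicator {0<..} x *\<^sub>R (exp (- x) * h x * \<phi> (exp (- x)))) \<partial>lborel) = 0"
    unfolding G_def set_lebesgue_integral_def by simp
  moreover have "integrable lborel (\<lambda>x. - (indicator {0<..} x *\<^sub>R (exp (- x) * h x * \<phi> (exp (- x)))))"
    using intG[OF c] unfolding set_integrable_def by simp
  ultimately have "AE x in lborel. - (indicator {0<..} x *\<^sub>R (exp (- x) * h x * \<phi> (exp (- x)))) = 0"
    by (subst (asm) integral_nonneg_eq_0_iff_AE) (use le in \<open>auto simp: indicator_def\<close>)
  then have "AE x in lborel. x \<notin> {x0 - \<epsilon><..<x0 + \<epsilon>}"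
  proof eventually_elim
    case (elim x)
    then show ?case using pos[of x] \<epsilon>(2)[of x] by (auto simp: indicator_def split: if_splits)
  qed
  then have "emeasure lborel {x0 - \<epsilon><..<x0 + \<epsilon>} = 0"
    using AE_iff_measurable[of "{x0 - \<epsilon><..<x0 + \<epsilon>}" lborel "\<lambda>x. x \<notin> {x0 - \<epsilon><..<x0 + \<epsilon>}"]
    by (simp add: greaterThanLessThan_eq greaterThan_def lessThan_def Collect_conj_eq[symmetric])
  then show False using \<epsilon>(1) by auto
qed

text \<open>The differences \<open>f - g\<close> and \<open>g - f\<close> both have transform zero,
  which is completely monotone, so both are nonnegative; continuity yields equality at every
  point.\<close>

lemma laplace_unique:
  fixes f g :: "real \<Rightarrow> real"
  assumes f: "\<And>s. s > 0 \<Longrightarrow> set_integrable lborel {0<..} (\<lambda>x. exp (- (s * x)) * f x)"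
    and g: "\<And>s. s > 0 \<Longrightarrow> set_integrable lborel {0<..} (\<lambda>x. exp (- (s * x)) * g x)"
    and eq: "\<And>s. s > 0 \<Longrightarrow> (LINT x:{0<..}|lborel. exp (- (s * x)) * f x) = (LINT x:{0<..}|lborel. exp (- (s * x)) * g x)"
    and "continuous_on {0<..} f" "continuous_on {0<..} g" "x > 0"
  shows "f x = g x"
proof -
  have *: "0 \<le> f x - g x"
    if f: "\<And>s. s > 0 \<Longrightarrow> set_integrable lborel {0<..} (\<lambda>x. exp (- (s * x)) * f x)"
    and g: "\<And>s. s > 0 \<Longrightarrow> set_integrable lborel {0<..} (\<lambda>x. exp (- (s * x)) * g x)"
    and eq: "\<And>s. s > 0 \<Longrightarrow> (LINT x:{0<..}|lborel. exp (- (s * x)) * f x) = (LINT x:{0<..}|lborel. exp (- (s * x)) * g x)"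
    and c: "continuous_on {0<..} f" "continuous_on {0<..} g" for f g :: "real \<Rightarrow> real"
  proof (rule laplace_cmono_imp_nonneg[of "\<lambda>x. f x - g x", OF _ _ _ \<open>x > 0\<close>])
    show "continuous_on {0<..} (\<lambda>x. f x - g x)" by (intro continuous_intros c)
    show "set_integrable lborel {0<..} (\<lambda>x. exp (- (s * x)) * (f x - g x))" if "s > 0" for s
      unfolding right_diff_distrib using that by (intro set_integral_diff f g)
    show "cmono n (\<lambda>s. LINT x:{0<..}|lborel. exp (- (s * x)) * (f x - g x))" for n
      by (rule cmono_cong[OF cmono_zero]) (simp add: right_diff_distrib set_integral_diff(2)[OF f g] eq)
  qed
  show ?thesis
    using *[OF f g eq] *[OF g f eq[symmetric]] assms(4,5) by fastforce
qed

subsection \<open>The Bromwich integral of the stable law\<close>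

text \<open>The continuation of \<open>exp (- (s powr \<alpha>))\<close> from the positive reals,
  through the principal branch, whose cut stays outside the open right half-plane.\<close>

definition cexp_powr :: "real \<Rightarrow> complex \<Rightarrow> complex" where
  "cexp_powr \<alpha> z = exp (- (z powr of_real \<alpha>))"

text \<open>In the closed right half-plane the argument is at most \<open>pi / 2\<close> in modulus,
  so the real part of the power is at least \<open>cos (\<alpha> * pi / 2)\<close> times its
  modulus. This controls both the arc and the imaginary axis.\<close>

lemma norm_cexp_powr_le:
  assumes "0 < \<alpha>" "\<alpha> < 1" "0 \<le> Re z"
  shows "cmod (cexp_powr \<alpha> z) \<le> exp (- (cos (\<alpha> * pi / 2) * cmod z powr \<alpha>))"
proof (cases "z = 0")
  case False
  have *: "\<bar>Im (Ln z)\<bar> \<le> pi / 2" using Re_Ln_pos_le[OF False] assms by simp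
  have "cos (\<alpha> * pi / 2) \<le> cos \<bar>\<alpha> * Im (Ln z)\<bar>"
  proof (rule cos_monotone_0_pi_le)
    show "\<bar>\<alpha> * Im (Ln z)\<bar> \<le> \<alpha> * pi / 2" using * assms by (simp add: abs_mult mult_left_mono flip: times_divide_eq_right)
    show "\<alpha> * pi / 2 \<le> pi" using mult_right_mono[of \<alpha> 2 pi] assms by simp
  qed simp
  then have "cos (\<alpha> * pi / 2) * cmod z powr \<alpha> \<le> cos (\<alpha> * Im (Ln z)) * cmod z powr \<alpha>"
    by (intro mult_right_mono) auto
  also have "\<dots> = Re (z powr of_real \<alpha>)"
    using False by (simp add: powr_def Re_exp mult_ac)
  finally show ?thesis by (simp add: cexp_powr_def)
qed (simp add: cexp_powr_def)

lemma cexp_powr_of_real: "0 < s \<Longrightarrow> cexp_powr \<alpha> (of_real s) = of_real (exp (- (s powr \<alpha>)))"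
  by (simp add: cexp_powr_def powr_of_real exp_of_real[symmetric])

lemma cos_half_pos: "0 < \<alpha> \<Longrightarrow> \<alpha> < 1 \<Longrightarrow> 0 < cos (\<alpha> * pi / 2)" for \<alpha> :: real
  by (intro cos_gt_zero_pi) (auto simp: field_simps intro: order.strict_trans[of _ 0])

lemma continuous_on_cexp_powr:
  assumes "0 < \<alpha>" shows "continuous_on {z. 0 \<le> Re z} (cexp_powr \<alpha>)"
  unfolding cexp_powr_def[abs_def] using assms by (intro continuous_intros) auto

text \<open>Cauchy's formula on the right half-disc of radius \<open>R\<close>, traversed clockwise:
  up the imaginary axis and back along the arc. \<open>J\<close> is the integral over the axis, and
  the bound in the second claim is the contribution of the arc.\<close>

lemma contour_integral_half_disc:
  assumes \<alpha>: "0 < \<alpha>" "\<alpha> < 1" and s: "0 < s" "s < R"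
  obtains J where
    "((\<lambda>u. cexp_powr \<alpha> (Complex 0 u) / (Complex 0 u - of_real s)) has_integral J) {- R..R}"
    "cmod (J + 2 * pi * exp (- (s powr \<alpha>))) \<le> exp (- (cos (\<alpha> * pi / 2) * R powr \<alpha>)) / (R - s) * R * pi"
proof -
  define S where "S = cball 0 R \<inter> {z. 0 \<le> Re z}"
  define seg where "seg = linepath (Complex 0 (- R)) (Complex 0 R)"
  define arc where "arc = part_circlepath 0 R (pi / 2) (- (pi / 2))"
  let ?\<gamma> = "seg +++ arc" and ?s = "complex_of_real s"
  have R: "R > 0" using s by simp
  have e: "exp (\<i> * complex_of_real pi / 2) = \<i>" "exp (- (\<i> * complex_of_real pi / 2)) = - \<i>"
    using cis_conv_exp[of "pi / 2"] cis_conv_exp[of "- (pi / 2)"] by simp_all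
  have arc_ends: "pathstart arc = Complex 0 R" "pathfinish arc = Complex 0 (- R)"
    by (simp_all add: arc_def e Complex_eq mult.commute)
  have vp: "valid_path seg" "valid_path arc" by (simp_all add: seg_def arc_def)
  have vp': "valid_path ?\<gamma>" by (rule valid_path_join[OF vp]) (simp add: arc_ends seg_def)
  have seg: "Re w = 0 \<and> cmod w \<le> R" if "w \<in> path_image seg" for w
    using that R by (auto simp: seg_def closed_segment_same_Re closed_segment_eq_real_ivl cmod_eq_Im)
  have arc: "0 \<le> Re w \<and> cmod w = R" if w: "w \<in> path_image arc" for w
  proof -
    from w obtain t where t: "t \<in> closed_segment (pi/2) (- (pi / 2))" "w = R * cis t"
      unfolding arc_def path_image_part_circlepath' by auto
    then have "- (pi / 2) \<le> t" "t \<le> pi / 2" using pi_gt_zero by (auto simp: closed_segment_eq_real_ivl split: if_splits)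
    then show ?thesis using t(2) R cos_ge_zero[of t] by (auto simp: norm_mult)
  qed
  have pim: "path_image ?\<gamma> = path_image seg \<union> path_image arc"
    by (rule path_image_join) (simp add: arc_ends seg_def)
  have intS: "interior S = ball 0 R \<inter> {z. 0 < Re z}"
    using interior_halfspace_ge[of "1::complex" 0] by (simp add: S_def inner_complex_def)
  have in_S: "path_image ?\<gamma> \<subseteq> S - {?s}"
    unfolding pim S_def using seg arc s by fastforce
  have loop: "pathfinish ?\<gamma> = pathstart ?\<gamma>" by (simp add: arc_ends seg_def)
  \<comment> \<open>The branches \<open>Ln (s - w)\<close> and \<open>Ln (w - s)\<close> avoid their cuts on the segment and on the arc, respectively;
     this yields the winding number.\<close>
  have "((\<lambda>w. 1 / (w - ?s)) has_contour_integral (Ln (?s - pathfinish seg) - Ln (?s - pathstart seg))) seg"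
  proof (rule contour_integral_primitive[OF _ vp(1), where S = "{z. Re z < s}"])
    show "((\<lambda>w. Ln (?s - w)) has_field_derivative 1 / (x - ?s)) (at x within {z. Re z < s})"
      if "x \<in> {z. Re z < s}" for x
      using that by (auto intro!: derivative_eq_intros simp: complex_nonpos_Reals_iff inverse_eq_divide minus_divide_right)
  qed (use seg s in force)
  moreover have "((\<lambda>w. 1 / (w - ?s)) has_contour_integral (Ln (pathfinish arc - ?s) - Ln (pathstart arc - ?s))) arc"
  proof (rule contour_integral_primitive[OF _ vp(2), where S = "{z. z - ?s \<notin> \<real>\<^sub>\<le>\<^sub>0}"])
    show "((\<lambda>w. Ln (w - ?s)) has_field_derivative 1 / (x - ?s)) (at x within {z. z - ?s \<notin> \<real>\<^sub>\<le>\<^sub>0})"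
      if "x \<in> {z. z - ?s \<notin> \<real>\<^sub>\<le>\<^sub>0}" for x
      using that by (auto intro!: derivative_eq_intros simp: inverse_eq_divide)
    show "path_image arc \<subseteq> {z. z - ?s \<notin> \<real>\<^sub>\<le>\<^sub>0}"
    proof safe
      fix w assume w: "w \<in> path_image arc" "w - ?s \<in> \<real>\<^sub>\<le>\<^sub>0"
      then have "Im w = 0" "Re w \<le> s" by (auto simp: complex_nonpos_Reals_iff)
      with arc[OF w(1)] s show False by (auto simp: cmod_def)
    qed
  qed
  ultimately have "((\<lambda>w. 1 / (w - ?s)) has_contour_integral
     ((Ln (?s - pathfinish seg) - Ln (?s - pathstart seg)) + (Ln (pathfinish arc - ?s) - Ln (pathstart arc - ?s)))) ?\<gamma>"
    by (rule has_contour_integral_join[OF _ _ vp])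
  \<comment> \<open>The arguments of the two branches differ by a sign, so their logarithms differ
    by \<open>\<i> * pi\<close> up to sign at each of the two common endpoints. All else cancels and
    the total is \<open>- (2 * pi * \<i>)\<close>.\<close>
  also have "Ln (pathfinish arc - ?s) = Ln (?s - pathstart seg) - \<i> * pi"
  proof -
    have e1: "pathfinish arc - ?s = - (?s + Complex 0 R)" and e2: "?s - pathstart seg = ?s + Complex 0 R"
      and e3: "?s + Complex 0 R \<noteq> 0"
      using R by (auto simp: arc_ends seg_def complex_eq_iff)
    show ?thesis unfolding e1 e2 Ln_minus[OF e3] using R s by auto
  qed
  also have "Ln (pathstart arc - ?s) = Ln (?s - pathfinish seg) + \<i> * pi"
  proof -
    have e1: "pathstart arc - ?s = - (?s - Complex 0 R)" and e2: "?s - pathfinish seg = ?s - Complex 0 R"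
      and e3: "?s - Complex 0 R \<noteq> 0"
      using R by (auto simp: arc_ends seg_def complex_eq_iff)
    show ?thesis unfolding e1 e2 Ln_minus[OF e3] using R s by auto
  qed
  finally have "((\<lambda>w. 1 / (w - ?s)) has_contour_integral - (2 * pi * \<i>)) ?\<gamma>"
    by (simp add: algebra_simps)
  moreover have "?s \<notin> path_image ?\<gamma>" using in_S by blast
  ultimately have wn: "winding_number ?\<gamma> ?s = - 1"
    using winding_number_valid_path[OF vp', of ?s] by (auto dest!: contour_integral_unique)
  have "((\<lambda>w. cexp_powr \<alpha> w / (w - ?s)) has_contour_integral
      (2 * pi * \<i> * winding_number ?\<gamma> ?s * cexp_powr \<alpha> ?s)) ?\<gamma>"
  \<comment> \<open>This form asks for continuity on the closed half-disc and differentiability only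
    in its interior, which accommodates the branch point 0 on the boundary.\<close>
  proof (rule Cauchy_integral_formula_convex[OF _ finite.emptyI _ _ _ vp' in_S loop])
    show "convex S" unfolding S_def by (intro convex_Int convex_cball convex_halfspace_Re_ge)
    show "continuous_on S (cexp_powr \<alpha>)"
      by (rule continuous_on_subset[OF continuous_on_cexp_powr]) (use \<alpha> in \<open>auto simp: S_def\<close>)
    show "cexp_powr \<alpha> field_differentiable at x" if "x \<in> interior S - {}" for x
      using that unfolding cexp_powr_def[abs_def] intS field_differentiable_def
      by (auto intro!: exI derivative_eq_intros simp: complex_nonpos_Reals_iff)
    show "?s \<in> interior S" using s by (auto simp: intS)
  qed
  then have tot: "((\<lambda>w. cexp_powr \<alpha> w / (w - ?s)) has_contour_integral
      (- 2 * pi * \<i> * exp (- (s powr \<alpha>)))) ?\<gamma>"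
    using s by (simp add: wn cexp_powr_of_real)
  then have ci: "(\<lambda>w. cexp_powr \<alpha> w / (w - ?s)) contour_integrable_on seg"
     "(\<lambda>w. cexp_powr \<alpha> w / (w - ?s)) contour_integrable_on arc"
    using vp unfolding contour_integrable_on_def using contour_integrable_join[OF vp, unfolded contour_integrable_on_def] by blast+
  define I where "I = contour_integral seg (\<lambda>w. cexp_powr \<alpha> w / (w - ?s))"
  define K where "K = contour_integral arc (\<lambda>w. cexp_powr \<alpha> w / (w - ?s))"
  have IK: "I + K = - 2 * pi * \<i> * exp (- (s powr \<alpha>))"
    using contour_integral_unique[OF tot] contour_integral_join[OF ci vp] by (simp add: I_def K_def)
  have "cmod K \<le> exp (- (cos (\<alpha> * pi / 2) * R powr \<alpha>)) / (R - s) * R * \<bar>- (pi / 2) - pi / 2\<bar>"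
    unfolding K_def arc_def
  proof (rule contour_integral_bound_part_circlepath)
    fix w assume "w \<in> path_image (part_circlepath 0 R (pi / 2) (- (pi / 2)))"
    then have w: "0 \<le> Re w" "cmod w = R" using arc by (auto simp: arc_def)
    have "R - s \<le> cmod (w - ?s)" using norm_triangle_ineq2[of w ?s] w s by simp
    then show "cmod (cexp_powr \<alpha> w / (w - ?s)) \<le> exp (- (cos (\<alpha> * pi / 2) * R powr \<alpha>)) / (R - s)"
      using norm_cexp_powr_le[OF \<alpha> w(1)] s w(2) by (simp add: norm_divide frac_le)
  qed (use s R ci(2) in \<open>auto simp: arc_def\<close>)
  \<comment> \<open>On the segment \<open>w = \<i> * u\<close>, so the integral over
    \<open>u\<close> is \<open>- \<i> * I\<close>.\<close>
  moreover have "- \<i> * I + 2 * pi * exp (- (s powr \<alpha>)) = \<i> * K"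
  proof -
    have "\<i> * K = \<i> * (I + K) - \<i> * I" by (simp add: algebra_simps)
    then show ?thesis unfolding IK by (simp add: algebra_simps)
  qed
  ultimately have "cmod (- \<i> * I + 2 * pi * exp (- (s powr \<alpha>))) \<le>
     exp (- (cos (\<alpha> * pi / 2) * R powr \<alpha>)) / (R - s) * R * pi"
    by (simp add: norm_mult)
  moreover have "((\<lambda>u. cexp_powr \<alpha> (Complex 0 u) / (Complex 0 u - ?s)) has_integral (- \<i> * I)) {- R..R}"
    using has_contour_integral_integral[OF ci(1)] R unfolding I_def[symmetric] unfolding seg_def
    by (subst (asm) has_contour_integral_linepath_same_Re_iff[where c = 0 and a = "- R" and b = R]) auto
  ultimately show ?thesis using that by blast
qed

subsection \<open>Integrals on the half-line\<close>

text \<open>A nonnegative gauge-integrable function is absolutely integrable, and Borel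
  measurability brings this down from the completed measure to \<open>lborel\<close>. It links the
  two notions of integral used throughout.\<close>

lemma nonneg_has_integral_imp_set_lborel:
  fixes f :: "real \<Rightarrow> real"
  assumes S: "S \<in> sets borel" and m: "set_borel_measurable borel S f"
    and nn: "\<And>x. x \<in> S \<Longrightarrow> 0 \<le> f x" and I: "(f has_integral I) S"
  shows "set_integrable lborel S f" "(LINT x:S|lborel. f x) = I"
proof -
  have "f absolutely_integrable_on S"
    using I nn by (intro nonnegative_absolutely_integrable_1) auto
  then show *: "set_integrable lborel S f"
    using m unfolding set_integrable_def set_borel_measurable_def by (simp add: integrable_completion)
  show "(LINT x:S|lborel. f x) = I"
    using set_borel_integral_eq_integral[OF *] I by (simp add: integral_unique)
qed

lemma set_lborel_imp_has_integral:
  fixes f :: "real \<Rightarrow> real"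
  assumes "set_integrable lborel S f"
  shows "(f has_integral (LINT x:S|lborel. f x)) S"
  using set_borel_integral_eq_integral[OF assms] by (simp add: has_integral_iff)

lemma has_integral_Ioi_iff_Ici:
  fixes f :: "real \<Rightarrow> 'b :: banach"
  shows "(f has_integral I) {a<..} \<longleftrightarrow> (f has_integral I) {a..}"
  by (rule has_integral_spike_set_eq) (auto intro: negligible_subset[of "{a}"])

lemma nn_integral_imp_has_integral:
  fixes f :: "real \<Rightarrow> real"
  assumes "f \<in> borel_measurable borel" "\<And>x. x > 0 \<Longrightarrow> 0 \<le> f x" "0 \<le> I"
    and "(\<integral>\<^sup>+x. ennreal (indicator {0<..} x * f x) \<partial>lborel) = ennreal I"
  shows "(f has_integral I) {0<..}"
proof -
  have "((\<lambda>x. indicator {0<..} x * f x) has_integral I) UNIV"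
    by (rule nn_integral_has_integral) (use assms in \<open>auto simp: indicator_def\<close>)
  then show ?thesis
    by (simp add: indicator_def of_bool_def if_distrib[of "\<lambda>x. x * f y" for y] cong: if_cong)
       (simp add: has_integral_restrict_UNIV[of "{0<..}" f, simplified])
qed

text \<open>For either sign of \<open>a\<close>, the map \<open>s \<mapsto> c * s powr a\<close> is
  a bijection of the positive half-line. Nonnegativity supplies the absolute integrability that the
  change of variables requires.\<close>

lemma has_integral_powr_substitution:
  fixes f :: "real \<Rightarrow> real"
  assumes nn: "\<And>x. x > 0 \<Longrightarrow> 0 \<le> f x" and I: "(f has_integral I) {0<..}" and c: "c > 0" and a: "a \<noteq> 0"
  shows "((\<lambda>s. c * \<bar>a\<bar> * s powr (a - 1) * f (c * s powr a)) has_integral I) {0<..}"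
proof -
  let ?g = "\<lambda>s. c * s powr a" and ?g' = "\<lambda>s. c * a * s powr (a - 1)"
  have img: "?g ` {0<..} = {0<..}"
  proof safe
    fix y :: real assume "y > 0"
    then have "y = ?g ((y / c) powr (1 / a))" using c a by (simp add: powr_powr)
    moreover have "(y / c) powr (1 / a) > 0" using \<open>y > 0\<close> c by simp
    ultimately show "y \<in> ?g ` {0<..}" by blast
  qed (use c in auto)
  have inj: "inj_on ?g {0<..}"
  proof (rule inj_onI)
    fix x y :: real assume "x \<in> {0<..}" "y \<in> {0<..}" "c * x powr a = c * y powr a"
    then have "(x powr a) powr (1 / a) = (y powr a) powr (1 / a)" using c by simp
    then show "x = y" using \<open>x \<in> {0<..}\<close> \<open>y \<in> {0<..}\<close> a by (simp add: powr_powr)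
  qed
  have "f absolutely_integrable_on ?g ` {0<..} \<and> integral (?g ` {0<..}) f = I"
    unfolding img using I nn by (auto intro!: nonnegative_absolutely_integrable_1)
  then have "(\<lambda>s. \<bar>?g' s\<bar> * f (?g s)) absolutely_integrable_on {0<..} \<and> integral {0<..} (\<lambda>s. \<bar>?g' s\<bar> * f (?g s)) = I"
    using inj c
    by (subst has_absolute_integral_change_of_variables_1')
       (auto intro!: derivative_eq_intros simp: powr_diff)
  then have "((\<lambda>s. \<bar>?g' s\<bar> * f (?g s)) has_integral I) {0<..}"
    using set_lebesgue_integral_eq_integral(1) by (auto simp: has_integral_iff)
  then show ?thesis
    by (rule has_integral_eq[rotated]) (use c in \<open>auto simp: abs_mult\<close>)
qed

text \<open>Euler's integral for \<open>Gamma (p / \<alpha>)\<close> after substituting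
  \<open>c * s powr \<alpha>\<close>. With \<open>\<alpha> = 1\<close> it is the Laplace transform
  of a power.\<close>

lemma has_integral_powr_exp_powr:
  fixes p \<alpha> c :: real
  assumes p: "p > 0" and \<alpha>: "\<alpha> > 0" and c: "c > 0"
  shows "((\<lambda>s. s powr (p - 1) * exp (- (c * s powr \<alpha>))) has_integral Gamma (p / \<alpha>) / (\<alpha> * c powr (p / \<alpha>))) {0<..}"
proof -
  have "((\<lambda>t. t powr (p / \<alpha> - 1) / exp t) has_integral Gamma (p / \<alpha>)) {0<..}"
    using Gamma_integral_real[of "p / \<alpha>"] p \<alpha> by (simp add: has_integral_Ioi_iff_Ici)
  from has_integral_powr_substitution[OF _ this c, of \<alpha>]
  have "((\<lambda>s. c * \<bar>\<alpha>\<bar> * s powr (\<alpha> - 1) * ((c * s powr \<alpha>) powr (p / \<alpha> - 1) / exp (c * s powr \<alpha>)))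
     has_integral Gamma (p / \<alpha>)) {0<..}"
    using \<alpha> by simp
  from has_integral_mult_right[OF this, of "1 / (\<alpha> * c powr (p / \<alpha>))"]
  have "((\<lambda>s. 1 / (\<alpha> * c powr (p / \<alpha>)) * (c * \<bar>\<alpha>\<bar> * s powr (\<alpha> - 1) * ((c * s powr \<alpha>) powr (p / \<alpha> - 1) / exp (c * s powr \<alpha>))))
     has_integral Gamma (p / \<alpha>) / (\<alpha> * c powr (p / \<alpha>))) {0<..}" by simp
  then show ?thesis
  proof (rule has_integral_eq[rotated])
    fix s :: real assume "s \<in> {0<..}"
    then have s: "s > 0" by simp
    have "s powr (\<alpha> - 1) * (c * s powr \<alpha>) powr (p / \<alpha> - 1) = c powr (p / \<alpha> - 1) * s powr (p - 1)"
      using s c \<alpha> by (simp add: powr_mult powr_powr powr_add[symmetric] field_simps)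
    moreover have "c powr (p / \<alpha>) = c * c powr (p / \<alpha> - 1)" using c by (simp add: powr_diff)
    ultimately have "1 / (\<alpha> * c powr (p / \<alpha>)) * (c * \<bar>\<alpha>\<bar> * (s powr (\<alpha> - 1) * (c * s powr \<alpha>) powr (p / \<alpha> - 1)) / exp (c * s powr \<alpha>))
      = s powr (p - 1) * exp (- (c * s powr \<alpha>))"
      using s c \<alpha> by (simp add: exp_minus divide_simps)
    then show "1 / (\<alpha> * c powr (p / \<alpha>)) * (c * \<bar>\<alpha>\<bar> * s powr (\<alpha> - 1) * ((c * s powr \<alpha>) powr (p / \<alpha> - 1) / exp (c * s powr \<alpha>)))
      = s powr (p - 1) * exp (- (c * s powr \<alpha>))" by (simp add: mult.assoc)
  qed
qed

lemma integrable_exp_abs_powr: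
  fixes c \<alpha> :: real
  assumes \<alpha>: "\<alpha> > 0" and c: "c > 0"
  shows "integrable lborel (\<lambda>u. exp (- (c * \<bar>u\<bar> powr \<alpha>)))"
proof -
  let ?f = "\<lambda>u::real. exp (- (c * \<bar>u\<bar> powr \<alpha>))"
  have "((\<lambda>s. exp (- (c * s powr \<alpha>))) has_integral Gamma (1 / \<alpha>) / (\<alpha> * c powr (1 / \<alpha>))) {0<..}"
    by (rule has_integral_eq[OF _ has_integral_powr_exp_powr[of 1 \<alpha> c]]) (use assms in auto)
  then have "(?f has_integral Gamma (1 / \<alpha>) / (\<alpha> * c powr (1 / \<alpha>))) {0<..}"
    by (rule has_integral_eq[rotated]) auto
  then have pos: "set_integrable lborel {0<..} ?f"
    by (intro nonneg_has_integral_imp_set_lborel(1)) (auto simp: set_borel_measurable_def)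
  have "integrable lborel (\<lambda>u. indicator {0<..} (0 + - 1 * u) *\<^sub>R ?f (0 + - 1 * u))"
    using pos unfolding set_integrable_def by (intro lborel_integrable_real_affine) auto
  then have neg: "set_integrable lborel {..<0} ?f"
    unfolding set_integrable_def by (rule Bochner_Integration.integrable_cong[THEN iffD1, rotated 2]) (auto simp: indicator_def)
  have "set_integrable lborel ({..<0} \<union> {0} \<union> {0<..}) ?f"
    by (intro set_integrable_Un pos neg) auto
  moreover have "{..<0} \<union> {0} \<union> {0<..} = (UNIV :: real set)" by auto
  ultimately show ?thesis by (simp add: set_integrable_def)
qed

subsection \<open>The stable density\<close>

text \<open>The integrand is \<open>exp (w * x)\<close> with \<open>w = \<i> * u - s\<close>, whose
  real part is negative. The value \<open>- 1 / w\<close> provides the Cauchy kernel when the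
  Fourier integral is Laplace transformed.\<close>

lemma laplace_cis:
  fixes s u :: real
  assumes s: "s > 0"
  shows "set_integrable lborel {0<..} (\<lambda>x. of_real (exp (- (s * x))) * cis (u * x))"
    and "(LINT x:{0<..}|lborel. of_real (exp (- (s * x))) * cis (u * x)) = - 1 / (Complex 0 u - of_real s)"
proof -
  define w where "w = Complex 0 u - of_real s"
  have w: "w \<noteq> 0" using s by (auto simp: w_def complex_eq_iff)
  have eq: "of_real (exp (- (s * x))) * cis (u * x) = exp (w * of_real x)" for x
    by (simp add: w_def cis_conv_exp exp_of_real[symmetric] exp_add[symmetric] Complex_eq algebra_simps)
  have nrm: "cmod (exp (w * of_real x)) = exp (- (s * x))" for x
    by (simp add: w_def Complex_eq algebra_simps)
  have "((\<lambda>x. exp (- (s * x))) has_integral (1 / s)) {0<..}"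
    using has_integral_exp_minus_to_infinity[OF s, of 0] by (simp add: has_integral_Ioi_iff_Ici)
  then have "set_integrable lborel {0<..} (\<lambda>x. exp (- (s * x)))"
    by (intro nonneg_has_integral_imp_set_lborel(1)) (auto simp: set_borel_measurable_def)
  then have int: "set_integrable lborel {0<..} (\<lambda>x. exp (w * complex_of_real x))"
    by (rule set_integrable_bound) (auto simp: set_borel_measurable_def nrm simp del: norm_exp_eq_Re)
  then show "set_integrable lborel {0<..} (\<lambda>x. of_real (exp (- (s * x))) * cis (u * x))"
    unfolding eq .
  have "(LBINT x=ereal 0..\<infinity>. exp (w * complex_of_real x)) = 0 - 1 / w"
  proof (rule interval_integral_FTC_integrable[where F = "\<lambda>x. exp (w * complex_of_real x) / w"])
    show "((\<lambda>x. exp (w * complex_of_real x) / w) has_vector_derivative exp (w * complex_of_real x)) (at x)" for x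
      by (rule has_vector_derivative_real_field) (use w in \<open>auto intro!: derivative_eq_intros\<close>)
    show "isCont (\<lambda>x. exp (w * complex_of_real x)) x" for x by (intro continuous_intros)
    show "set_integrable lborel (einterval (ereal 0) \<infinity>) (\<lambda>x. exp (w * complex_of_real x))"
      using int by simp
    show "(((\<lambda>x. exp (w * complex_of_real x) / w) \<circ> real_of_ereal) \<longlongrightarrow> 1 / w) (at_right (ereal 0))"
      unfolding ereal_tendsto_simps
      by (rule tendsto_eq_intros refl w | simp)+
    show "(((\<lambda>x. exp (w * complex_of_real x) / w) \<circ> real_of_ereal) \<longlongrightarrow> 0) (at_left \<infinity>)"
      unfolding ereal_tendsto_simps
    proof (rule tendsto_norm_zero_cancel)
      have "((\<lambda>x. exp (- (s * x))) \<longlongrightarrow> 0) at_top"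
        using s by real_asymp
      then have "((\<lambda>x. exp (- (s * x)) / cmod w) \<longlongrightarrow> 0) at_top"
        by (rule tendsto_divide_zero)
      then show "((\<lambda>x. cmod (exp (w * complex_of_real x) / w)) \<longlongrightarrow> 0) at_top"
        by (simp add: norm_divide nrm del: norm_exp_eq_Re)
    qed
  qed simp
  then show "(LINT x:{0<..}|lborel. of_real (exp (- (s * x))) * cis (u * x)) = - 1 / (Complex 0 u - of_real s)"
    unfolding eq by (simp add: interval_integral_to_infinity_eq w_def)
qed

text \<open>The inverse Laplace integral along the imaginary axis, parametrised by
  \<open>z = \<i> * u\<close> and without its factor \<open>1 / (2 * pi)\<close>.\<close>

definition bromwich :: "real \<Rightarrow> real \<Rightarrow> complex" where
  "bromwich \<alpha> x = (LINT u|lborel. cis (u * x) * cexp_powr \<alpha> (Complex 0 u))"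

text \<open>Passing to the real part is harmless, since the Laplace transform to be matched is
  real.\<close>

definition stable_fun :: "real \<Rightarrow> real \<Rightarrow> real" where
  "stable_fun \<alpha> x = Re (bromwich \<alpha> x) / (2 * pi)"

context
  fixes \<alpha> :: real assumes \<alpha>: "0 < \<alpha>" "\<alpha> < 1"
begin

lemma measurable_cexp_powr_imag [measurable]: "(\<lambda>u. cexp_powr \<alpha> (Complex 0 u)) \<in> borel_measurable borel"
proof (rule borel_measurable_continuous_onI)
  have "continuous_on UNIV (\<lambda>u::real. \<i> * of_real u)" by (intro continuous_intros)
  then show "continuous_on UNIV (\<lambda>u. cexp_powr \<alpha> (Complex 0 u))"
    by (intro continuous_on_compose2[OF continuous_on_cexp_powr]) (use \<alpha> in \<open>auto simp: Complex_eq\<close>)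
qed

lemma norm_cexp_powr_imag_le:
  "cmod (cexp_powr \<alpha> (Complex 0 u)) \<le> exp (- (cos (\<alpha> * pi / 2) * \<bar>u\<bar> powr \<alpha>))"
  using norm_cexp_powr_le[OF \<alpha>, of "Complex 0 u"] by (simp add: cmod_def)

lemma integrable_cexp_powr_imag: "integrable lborel (\<lambda>u. cexp_powr \<alpha> (Complex 0 u))"
  by (rule Bochner_Integration.integrable_bound[OF integrable_exp_abs_powr[OF \<alpha>(1) cos_half_pos[OF \<alpha>]]])
     (use norm_cexp_powr_imag_le in auto)

lemma isCont_bromwich: "isCont (bromwich \<alpha>) x"
  unfolding continuous_at_sequentially
proof (intro allI impI)
  fix X :: "nat \<Rightarrow> real" assume X: "X \<longlonglongrightarrow> x"
  show "(bromwich \<alpha> \<circ> X) \<longlonglongrightarrow> bromwich \<alpha> x"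
    unfolding bromwich_def o_def
  proof (rule integral_dominated_convergence[where w = "\<lambda>u. cmod (cexp_powr \<alpha> (Complex 0 u))"])
    show "AE u in lborel. (\<lambda>n. cis (u * X n) * cexp_powr \<alpha> (Complex 0 u)) \<longlonglongrightarrow> cis (u * x) * cexp_powr \<alpha> (Complex 0 u)"
      unfolding cis_conv_exp by (intro AE_I2 tendsto_intros X)
  qed (use integrable_cexp_powr_imag in \<open>auto simp: norm_mult cis_conv_exp\<close>)
qed

lemma continuous_on_stable_fun: "continuous_on A (stable_fun \<alpha>)"
  unfolding stable_fun_def[abs_def]
  by (intro continuous_at_imp_continuous_on ballI continuous_intros isCont_bromwich) auto

text \<open>Let the radius of the half-disc tend to infinity through the integers: the arc term
  vanishes by exponential decay, and dominated convergence handles the axis.\<close>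

lemma cauchy_imag_axis:
  assumes s: "s > 0"
  shows "integrable lborel (\<lambda>u. cexp_powr \<alpha> (Complex 0 u) / (Complex 0 u - of_real s))"
    and "(LINT u|lborel. cexp_powr \<alpha> (Complex 0 u) / (Complex 0 u - of_real s)) = - (2 * pi * exp (- (s powr \<alpha>)))"
proof -
  let ?k = "\<lambda>u. cexp_powr \<alpha> (Complex 0 u) / (Complex 0 u - of_real s)"
  let ?c = "cos (\<alpha> * pi / 2)"
  have [measurable]: "Complex 0 \<in> borel_measurable borel"
    unfolding Complex_eq[abs_def] by measurable
  have ge: "s \<le> cmod (Complex 0 u - of_real s)" for u
    using abs_Re_le_cmod[of "Complex 0 u - of_real s"] s by simp
  show int: "integrable lborel ?k"
  proof (rule Bochner_Integration.integrable_bound)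
    show "integrable lborel (\<lambda>u. cexp_powr \<alpha> (Complex 0 u) / of_real s)"
      using integrable_cexp_powr_imag by simp
    show "AE u in lborel. cmod (?k u) \<le> cmod (cexp_powr \<alpha> (Complex 0 u) / of_real s)"
      using ge s by (intro AE_I2) (auto simp: norm_divide intro!: frac_le)
  qed auto
  have lim: "(\<lambda>n. LINT u|lborel. indicator {- real n..real n} u *\<^sub>R ?k u) \<longlonglongrightarrow> (LINT u|lborel. ?k u)"
  proof (rule integral_dominated_convergence[where w = "\<lambda>u. cmod (?k u)"])
    show "AE u in lborel. (\<lambda>n. indicator {- real n..real n} u *\<^sub>R ?k u) \<longlonglongrightarrow> ?k u"
    proof (intro AE_I2 tendsto_eventually)
      fix u :: real
      obtain N where "\<bar>u\<bar> \<le> real N" using real_arch_simple by blast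
      then show "\<forall>\<^sub>F n in sequentially. indicator {- real n..real n} u *\<^sub>R ?k u = ?k u"
        unfolding eventually_sequentially by (intro exI[of _ N]) (auto simp: indicator_def)
    qed
  qed (use int in \<open>auto simp: indicator_def\<close>)
  have "(\<lambda>n. (LINT u|lborel. indicator {- real n..real n} u *\<^sub>R ?k u) + 2 * pi * exp (- (s powr \<alpha>))) \<longlonglongrightarrow> 0"
  proof (rule Lim_null_comparison)
    show "\<forall>\<^sub>F n in sequentially. cmod ((LINT u|lborel. indicator {- real n..real n} u *\<^sub>R ?k u) + 2 * pi * exp (- (s powr \<alpha>)))
       \<le> exp (- (?c * real n powr \<alpha>)) / (real n - s) * real n * pi"
      using eventually_gt_at_top[of "nat \<lceil>s\<rceil>"]
    proof eventually_elim
      case (elim n)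
      then have "s < real n" by linarith
      then obtain J where
        J: "(?k has_integral J) {- real n..real n}"
        "cmod (J + 2 * pi * exp (- (s powr \<alpha>))) \<le> exp (- (?c * real n powr \<alpha>)) / (real n - s) * real n * pi"
        by (rule contour_integral_half_disc[OF \<alpha> s])
      have "set_integrable lborel {- real n..real n} ?k"
        unfolding set_integrable_def using int by (intro integrable_mult_indicator) auto
      from set_borel_integral_eq_integral(2)[OF this] J(1)
      have "(LINT u|lborel. indicator {- real n..real n} u *\<^sub>R ?k u) = J"
        by (simp add: set_lebesgue_integral_def integral_unique)
      with J(2) show ?case by simp
    qed
    have "?c > 0" by (rule cos_half_pos[OF \<alpha>])
    then show "(\<lambda>n. exp (- (?c * real n powr \<alpha>)) / (real n - s) * real n * pi) \<longlonglongrightarrow> 0"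
      using \<alpha> by real_asymp
  qed
  moreover have "(\<lambda>n. (LINT u|lborel. indicator {- real n..real n} u *\<^sub>R ?k u) + 2 * pi * exp (- (s powr \<alpha>)))
     \<longlonglongrightarrow> (LINT u|lborel. ?k u) + 2 * pi * exp (- (s powr \<alpha>))"
    by (intro tendsto_intros lim)
  ultimately have "0 = (LINT u|lborel. ?k u) + 2 * pi * exp (- (s powr \<alpha>))"
    by (rule LIMSEQ_unique)
  then show "(LINT u|lborel. ?k u) = - (2 * pi * exp (- (s powr \<alpha>)))"
    by (simp add: eq_neg_iff_add_eq_0)
qed

text \<open>By Fubini the transform in \<open>x\<close> may be taken first. It turns each character
  into the Cauchy kernel, and \<open>cauchy_imag_axis\<close> evaluates the remaining integral over
  \<open>u\<close>.\<close>

lemma laplace_stable_fun: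
  assumes s: "s > 0"
  shows "set_integrable lborel {0<..} (\<lambda>x. exp (- (s * x)) * stable_fun \<alpha> x)"
    and "(LINT x:{0<..}|lborel. exp (- (s * x)) * stable_fun \<alpha> x) = exp (- (s powr \<alpha>))"
proof -
  let ?F = "\<lambda>u. cexp_powr \<alpha> (Complex 0 u)"
  let ?e = "\<lambda>u x. indicator {0<..} x *\<^sub>R (of_real (exp (- (s * x))) * cis (u * x)) :: complex"
  define f where "f = (\<lambda>(u, x). ?e u x * ?F u)"
  have [measurable]: "cis \<in> borel_measurable borel"
    unfolding cis_conv_exp[abs_def] by measurable
  have "integrable (lborel \<Otimes>\<^sub>M lborel) f"
  proof (rule lborel_pair.Fubini_integrable)
    show "f \<in> borel_measurable (lborel \<Otimes>\<^sub>M lborel)" unfolding f_def by measurable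
    have "(LINT x|lborel. cmod (f (u, x))) = cmod (?F u) * (LINT x:{0<..}|lborel. exp (- (s * x)))" for u
    proof -
      have "(LINT x|lborel. cmod (f (u, x))) = (LINT x|lborel. cmod (?F u) * (indicator {0<..} x * exp (- (s * x))))"
        by (intro Bochner_Integration.integral_cong) (auto simp: f_def norm_mult)
      then show ?thesis by (simp add: set_lebesgue_integral_def)
    qed
    then show "integrable lborel (\<lambda>u. LINT x|lborel. cmod (f (u, x)))"
      using integrable_cexp_powr_imag by simp
    show "AE u in lborel. integrable lborel (\<lambda>x. f (u, x))"
      using laplace_cis(1)[OF s] unfolding f_def prod.case set_integrable_def
      by (intro AE_I2 integrable_mult_left)
  qed
  then have int: "integrable (lborel \<Otimes>\<^sub>M lborel) (\<lambda>(u, x). ?e u x * ?F u)" by (simp add: f_def)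
  have inner: "(LINT u|lborel. ?e u x * ?F u) = indicator {0<..} x *\<^sub>R (of_real (exp (- (s * x))) * bromwich \<alpha> x)" for x
    by (simp add: bromwich_def mult.assoc)
  have "integrable lborel (\<lambda>x. LINT u|lborel. ?e u x * ?F u)"
    using lborel_pair.integrable_snd[OF int] by simp
  then have intB: "set_integrable lborel {0<..} (\<lambda>x. of_real (exp (- (s * x))) * bromwich \<alpha> x)"
    unfolding inner set_integrable_def .
  have "(LINT x:{0<..}|lborel. of_real (exp (- (s * x))) * bromwich \<alpha> x) = (LINT x|lborel. (LINT u|lborel. ?e u x * ?F u))"
    unfolding inner set_lebesgue_integral_def ..
  also have "\<dots> = (LINT u|lborel. (LINT x|lborel. ?e u x * ?F u))"
    using lborel_pair.Fubini_integral[OF int] by simp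
  also have "\<dots> = (LINT u|lborel. - (?F u / (Complex 0 u - of_real s)))"
    using laplace_cis(2)[OF s] unfolding integral_mult_left_zero by (simp add: set_lebesgue_integral_def)
  also have "\<dots> = 2 * pi * exp (- (s powr \<alpha>))"
    using cauchy_imag_axis(2)[OF s] by simp
  finally have I: "(LINT x:{0<..}|lborel. of_real (exp (- (s * x))) * bromwich \<alpha> x) = of_real (2 * pi * exp (- (s powr \<alpha>)))"
    by simp
  have eq: "indicator {0<..} x *\<^sub>R (exp (- (s * x)) * stable_fun \<alpha> x) =
    Re (indicator {0<..} x *\<^sub>R (of_real (exp (- (s * x))) * bromwich \<alpha> x)) / (2 * pi)" for x
    by (simp add: stable_fun_def)
  show "set_integrable lborel {0<..} (\<lambda>x. exp (- (s * x)) * stable_fun \<alpha> x)"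
    unfolding set_integrable_def eq using intB unfolding set_integrable_def by (intro integrable_divide integrable_Re)
  have "(LINT x:{0<..}|lborel. exp (- (s * x)) * stable_fun \<alpha> x) =
     Re (LINT x:{0<..}|lborel. of_real (exp (- (s * x))) * bromwich \<alpha> x) / (2 * pi)"
    unfolding set_lebesgue_integral_def eq using intB unfolding set_integrable_def
    by (simp only: integral_divide_zero integral_Re)
  then show "(LINT x:{0<..}|lborel. exp (- (s * x)) * stable_fun \<alpha> x) = exp (- (s powr \<alpha>))"
    unfolding I by simp
qed

lemma stable_fun_nonneg: "x > 0 \<Longrightarrow> 0 \<le> stable_fun \<alpha> x"
proof (rule laplace_cmono_imp_nonneg[where h = "stable_fun \<alpha>"])
  show "cmono n (\<lambda>s. LINT x:{0<..}|lborel. exp (- (s * x)) * stable_fun \<alpha> x)" for n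
    by (rule cmono_cong[OF cmono_exp_powr[of \<alpha> 1]]) (use \<alpha> in \<open>auto simp: laplace_stable_fun\<close>)
qed (use laplace_stable_fun continuous_on_stable_fun in auto)

end

section \<open>Stable densities: characterisation, existence and scaling\<close>

definition is_stable_pdf :: "real \<Rightarrow> real \<Rightarrow> (real \<Rightarrow> real) \<Rightarrow> bool" where
  "is_stable_pdf \<alpha> t f \<longleftrightarrow> (\<forall>x. 0 \<le> f x) \<and> (\<forall>x\<le>0. f x = 0) \<and> continuous_on {0<..} f \<and>
     (\<forall>s>0. ((\<lambda>x. exp (- (s * x)) * f x) has_integral exp (- (t * s powr \<alpha>))) {0..})"

lemma is_stable_pdf_laplace:
  assumes f: "is_stable_pdf \<alpha> t f" and s: "s > 0"
  shows "((\<lambda>x. exp (- (s * x)) * f x) has_integral exp (- (t * s powr \<alpha>))) {0<..}"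
    and "set_integrable lborel {0<..} (\<lambda>x. exp (- (s * x)) * f x)"
    and "(LINT x:{0<..}|lborel. exp (- (s * x)) * f x) = exp (- (t * s powr \<alpha>))"
proof -
  show I: "((\<lambda>x. exp (- (s * x)) * f x) has_integral exp (- (t * s powr \<alpha>))) {0<..}"
    using f s by (simp add: has_integral_Ioi_iff_Ici is_stable_pdf_def)
  have c: "continuous_on {0<..} f" and nn: "\<And>x. 0 \<le> f x" using f by (auto simp: is_stable_pdf_def)
  have m: "set_borel_measurable borel {0<..} (\<lambda>x. exp (- (s * x)) * f x)"
    unfolding set_borel_measurable_def
    by (intro borel_measurable_continuous_on_indicator continuous_intros c) auto
  show "set_integrable lborel {0<..} (\<lambda>x. exp (- (s * x)) * f x)"
    "(LINT x:{0<..}|lborel. exp (- (s * x)) * f x) = exp (- (t * s powr \<alpha>))"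
    using nonneg_has_integral_imp_set_lborel[OF _ m _ I] nn by auto
qed

lemma is_stable_pdf_unique:
  assumes f: "is_stable_pdf \<alpha> t f" and g: "is_stable_pdf \<alpha> t g"
  shows "f = g"
proof
  fix x
  show "f x = g x"
  proof (cases "x > 0")
    case True
    show ?thesis
      by (rule laplace_unique[OF is_stable_pdf_laplace(2)[OF f] is_stable_pdf_laplace(2)[OF g]])
         (use True f g in \<open>auto simp: is_stable_pdf_laplace(3)[OF f] is_stable_pdf_laplace(3)[OF g] is_stable_pdf_def[of \<alpha> t f] is_stable_pdf_def[of \<alpha> t g]\<close>)
  qed (use f g in \<open>auto simp: is_stable_pdf_def\<close>)
qed

lemma stable_pdf_eqI:
  assumes "is_stable_pdf \<alpha> t f"
  shows "stable_pdf \<alpha> t = f"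
  unfolding stable_pdf_def is_stable_pdf_def[symmetric]
  using assms is_stable_pdf_unique by (intro the_equality) auto

context
  fixes \<alpha> :: real assumes \<alpha>: "0 < \<alpha>" "\<alpha> < 1"
begin

text \<open>Existence for every scale. Dilating by \<open>t powr (- 1 / \<alpha>)\<close> replaces
  \<open>s\<close> by \<open>r = s * t powr (1 / \<alpha>)\<close> in the transform, and
  \<open>r powr \<alpha> = t * s powr \<alpha>\<close>.\<close>

lemma is_stable_pdf_scaled_stable_fun:
  assumes t: "t > 0"
  shows "is_stable_pdf \<alpha> t (\<lambda>x. if x \<le> 0 then 0 else t powr (- 1 / \<alpha>) * stable_fun \<alpha> (x * t powr (- 1 / \<alpha>)))"
    (is "is_stable_pdf \<alpha> t ?f")
  unfolding is_stable_pdf_def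
proof (intro conjI allI impI)
  let ?c = "t powr (- 1 / \<alpha>)"
  have c: "?c > 0" using t by simp
  show "0 \<le> ?f x" for x using stable_fun_nonneg[OF \<alpha>, of "x * ?c"] c by auto
  have "continuous_on {0<..} (\<lambda>x. ?c * stable_fun \<alpha> (x * ?c))"
    by (intro continuous_intros continuous_on_compose2[OF continuous_on_stable_fun[OF \<alpha>, of UNIV]]) auto
  then show "continuous_on {0<..} ?f"
    by (rule continuous_on_cong[THEN iffD1, rotated 2]) auto
  fix s :: real assume s: "s > 0"
  define r where "r = s * t powr (1 / \<alpha>)"
  have r: "r > 0" using s t by (simp add: r_def)
  have rc: "r * ?c = s" using t by (simp add: r_def powr_minus field_simps)
  have "((\<lambda>x. exp (- (r * x)) * stable_fun \<alpha> x) has_integral exp (- (r powr \<alpha>))) {0<..}"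
    using set_lborel_imp_has_integral[OF laplace_stable_fun(1)[OF \<alpha> r]] laplace_stable_fun(2)[OF \<alpha> r] by simp
  from has_integral_powr_substitution[OF _ this c, of 1]
  have "((\<lambda>x. ?c * x powr 0 * (exp (- (r * (?c * x powr 1))) * stable_fun \<alpha> (?c * x powr 1))) has_integral
    exp (- (r powr \<alpha>))) {0<..}"
    using stable_fun_nonneg[OF \<alpha>] by simp
  then have "((\<lambda>x. exp (- (s * x)) * ?f x) has_integral exp (- (r powr \<alpha>))) {0<..}"
    by (rule has_integral_eq[rotated]) (simp add: mult_ac flip: rc)
  also have "r powr \<alpha> = t * s powr \<alpha>"
    using s t \<alpha> by (simp add: r_def powr_mult powr_powr)
  finally show "((\<lambda>x. exp (- (s * x)) * ?f x) has_integral exp (- (t * s powr \<alpha>))) {0..}"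
    by (simp add: has_integral_Ioi_iff_Ici)
qed auto

lemma is_stable_pdf_stable_pdf: "t > 0 \<Longrightarrow> is_stable_pdf \<alpha> t (stable_pdf \<alpha> t)"
  using stable_pdf_eqI is_stable_pdf_scaled_stable_fun by metis

text \<open>By uniqueness both densities are rescalings of \<open>stable_fun\<close>, the one of
  scale 1 with factor 1.\<close>

lemma stable_pdf_scale:
  assumes t: "t > 0"
  shows "stable_pdf \<alpha> t x = t powr (- 1 / \<alpha>) * stable_pdf \<alpha> 1 (x * t powr (- 1 / \<alpha>))"
  using t by (simp add: stable_pdf_eqI[OF is_stable_pdf_scaled_stable_fun] mult_le_0_iff)

lemma stable_pdf_nonneg: "t > 0 \<Longrightarrow> 0 \<le> stable_pdf \<alpha> t x"
  using is_stable_pdf_stable_pdf by (auto simp: is_stable_pdf_def)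

lemma stable_pdf_eq_0: "t > 0 \<Longrightarrow> x \<le> 0 \<Longrightarrow> stable_pdf \<alpha> t x = 0"
  using is_stable_pdf_stable_pdf by (auto simp: is_stable_pdf_def)

lemma measurable_stable_pdf:
  assumes t: "t > 0" shows "stable_pdf \<alpha> t \<in> borel_measurable borel"
proof -
  have "continuous_on {0<..} (stable_pdf \<alpha> t)"
    using is_stable_pdf_stable_pdf[OF t] by (simp add: is_stable_pdf_def)
  then have "(\<lambda>x. indicator {0<..} x *\<^sub>R stable_pdf \<alpha> t x) \<in> borel_measurable borel"
    by (intro borel_measurable_continuous_on_indicator) auto
  also have "(\<lambda>x. indicator {0<..} x *\<^sub>R stable_pdf \<alpha> t x) = stable_pdf \<alpha> t"
    using stable_pdf_eq_0[OF t] by (auto simp: indicator_def fun_eq_iff not_less)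
  finally show ?thesis .
qed

end

subsection \<open>Prabhakar functions as mixtures\<close>

text \<open>Log-convexity of Gamma, applied to \<open>x + 1\<close> as a convex combination of
  \<open>x + \<alpha> + 1\<close> and \<open>x + \<alpha>\<close>. The bound decays like
  \<open>x powr (- \<alpha>)\<close>.\<close>

lemma Gamma_quotient_le:
  fixes x \<alpha> :: real
  assumes x: "x > 0" and \<alpha>: "0 < \<alpha>" "\<alpha> \<le> 1"
  shows "Gamma x / Gamma (x + \<alpha>) \<le> (x + \<alpha>) powr (1 - \<alpha>) / x"
proof -
  have "(ln \<circ> Gamma) ((1 - \<alpha>) *\<^sub>R (x + \<alpha> + 1) + \<alpha> *\<^sub>R (x + \<alpha>)) \<le>
     (1 - \<alpha>) * (ln \<circ> Gamma) (x + \<alpha> + 1) + \<alpha> * (ln \<circ> Gamma) (x + \<alpha>)"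
    by (rule convex_onD[OF log_convex_Gamma_real]) (use x \<alpha> in auto)
  also have "(1 - \<alpha>) *\<^sub>R (x + \<alpha> + 1) + \<alpha> *\<^sub>R (x + \<alpha>) = x + 1"
    by (simp add: algebra_simps)
  finally have "ln (Gamma (x + 1)) \<le> (1 - \<alpha>) * ln (Gamma (x + \<alpha> + 1)) + \<alpha> * ln (Gamma (x + \<alpha>))"
    by simp
  moreover have "Gamma (x + 1) = x * Gamma x" "Gamma (x + \<alpha> + 1) = (x + \<alpha>) * Gamma (x + \<alpha>)"
    using x \<alpha> by (auto intro!: Gamma_plus1 simp: nonpos_Ints_def)
  moreover have pos: "Gamma x > 0" "Gamma (x + \<alpha>) > 0" using x \<alpha> by (auto intro: Gamma_real_pos)
  moreover have "ln ((x + \<alpha>) * Gamma (x + \<alpha>)) = ln (x + \<alpha>) + ln (Gamma (x + \<alpha>))"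
    using x \<alpha> pos by (intro ln_mult_pos) auto
  ultimately have "ln (x * Gamma x) \<le> (1 - \<alpha>) * (ln (x + \<alpha>) + ln (Gamma (x + \<alpha>))) + \<alpha> * ln (Gamma (x + \<alpha>))"
    by metis
  also have "\<dots> = (1 - \<alpha>) * ln (x + \<alpha>) + ln (Gamma (x + \<alpha>))"
    by (simp add: algebra_simps)
  also have "\<dots> = ln ((x + \<alpha>) powr (1 - \<alpha>) * Gamma (x + \<alpha>))"
    using x \<alpha> pos by (subst ln_mult_pos) (auto simp: ln_powr)
  finally have "x * Gamma x \<le> (x + \<alpha>) powr (1 - \<alpha>) * Gamma (x + \<alpha>)"
    using x \<alpha> pos by (simp del: ln_mult)
  then show ?thesis using x pos by (simp add: field_simps)
qed

text \<open>Ratio test: the quotient of successive terms is at most \<open>q k\<close>, by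
  \<open>Gamma_quotient_le\<close>, and \<open>q\<close> tends to 0.\<close>

lemma summable_Prabhakar:
  fixes \<alpha> b c w :: real
  assumes \<alpha>: "0 < \<alpha>" "\<alpha> \<le> 1" and b: "b > 0" and c: "c > 0" and w: "w \<ge> 0"
  shows "summable (\<lambda>k. Gamma (c + real k) / (fact k * Gamma (\<alpha> * real k + b)) * w ^ k)"
proof -
  define q where "q = (\<lambda>k::nat. (c + real k) / (real k + 1) * w * ((\<alpha> * real k + b + \<alpha>) powr (1 - \<alpha>) / (\<alpha> * real k + b)))"
  have "q \<longlonglongrightarrow> 0"
  proof (cases "\<alpha> = 1")
    case True
    have "(\<lambda>k::nat. (c + real k) / (real k + 1) * w * (1 / (real k + b))) \<longlonglongrightarrow> 0" by real_asymp
    moreover have "q = (\<lambda>k. (c + real k) / (real k + 1) * w * (1 / (real k + b)))"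
      unfolding q_def True using b by (auto simp: fun_eq_iff)
    ultimately show ?thesis by simp
  next
    case False
    then have "\<alpha> < 1" using \<alpha> by simp
    then show ?thesis unfolding q_def using \<alpha> by real_asymp
  qed
  then have "\<forall>\<^sub>F k in sequentially. q k < 1 / 2" by (rule order_tendstoD) simp
  then obtain N where N: "\<And>k. k \<ge> N \<Longrightarrow> q k < 1 / 2" unfolding eventually_sequentially by blast
  let ?a = "\<lambda>k. Gamma (c + real k) / (fact k * Gamma (\<alpha> * real k + b)) * w ^ k"
  show ?thesis
  proof (rule summable_ratio_test[of "1 / 2" N])
    fix k assume "k \<ge> N"
    define x where "x = \<alpha> * real k + b"
    have x: "x > 0" using \<alpha> b by (simp add: x_def add_nonneg_pos)
    have pos: "Gamma x > 0" "Gamma (x + \<alpha>) > 0" "Gamma (c + real k) > 0"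
      using x \<alpha> c by (auto intro!: Gamma_real_pos add_pos_nonneg)
    have a0: "0 \<le> ?a k" for k
    proof -
      have "0 < \<alpha> * real k + b" "0 < c + real k"
        using \<alpha> b c by (auto intro: add_nonneg_pos add_pos_nonneg)
      then show ?thesis using w by (intro mult_nonneg_nonneg divide_nonneg_nonneg Gamma_real_nonneg) auto
    qed
    have "Gamma (c + real k + 1) = (c + real k) * Gamma (c + real k)"
      using c by (intro Gamma_plus1) (auto simp: nonpos_Ints_def)
    moreover have "c + real (Suc k) = c + real k + 1" "\<alpha> * real (Suc k) + b = x + \<alpha>"
      by (simp_all add: x_def algebra_simps)
    moreover have "(fact (Suc k) :: real) = (real k + 1) * fact k" by (simp add: algebra_simps)
    ultimately have "?a (Suc k) = (c + real k) * Gamma (c + real k) / ((real k + 1) * fact k * Gamma (x + \<alpha>)) * (w * w ^ k)"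
      by (simp only: power_Suc)
    also have "\<dots> = (c + real k) / (real k + 1) * w * (Gamma x / Gamma (x + \<alpha>)) * ?a k"
      unfolding x_def[symmetric] using pos by (simp add: mult_ac)
    also have "\<dots> \<le> q k * ?a k"
      unfolding q_def using Gamma_quotient_le[OF x \<alpha>] c w a0[of k]
      by (intro mult_right_mono mult_left_mono) (auto simp: x_def)
    also have "\<dots> \<le> 1 / 2 * ?a k"
      using N[OF \<open>k \<ge> N\<close>] a0[of k] by (intro mult_right_mono) auto
    finally show "norm (?a (Suc k)) \<le> 1 / 2 * norm (?a k)"
      using a0[of k] a0[of "Suc k"] by (simp only: real_norm_def abs_of_nonneg)
  qed simp
qed

text \<open>Tonelli for \<open>s powr (b - 1) * exp (- (s * y)) * g y\<close>: integrating over
  \<open>s\<close> first gives \<open>Gamma b * y powr (- b) * g y\<close>, integrating over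
  \<open>y\<close> first leaves an Euler integral with exponent \<open>b - d > 0\<close>.
  Nonnegative integrals deliver finiteness of the moment along with its value.\<close>

lemma has_integral_negative_moment:
  fixes g :: "real \<Rightarrow> real"
  assumes [measurable]: "g \<in> borel_measurable borel" and nn: "\<And>y. y > 0 \<Longrightarrow> 0 \<le> g y"
    and lap: "\<And>s. s > 0 \<Longrightarrow> ((\<lambda>y. exp (- (s * y)) * g y) has_integral s powr (- d) * exp (- (s powr \<alpha>))) {0<..}"
    and \<alpha>: "\<alpha> > 0" and d: "0 \<le> d" "d < b"
  shows "((\<lambda>y. y powr (- b) * g y) has_integral Gamma ((b - d) / \<alpha>) / (\<alpha> * Gamma b)) {0<..}"
proof -
  have b: "b > 0" using d by simp
  have Gb: "Gamma b > 0" using b by (rule Gamma_real_pos)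
  let ?h = "\<lambda>s y. ennreal (indicator {0<..} s * indicator {0<..} y * (s powr (b - 1) * exp (- (s * y)) * g y))"
  have 1: "(\<integral>\<^sup>+s. ?h s y \<partial>lborel) = ennreal (indicator {0<..} y * (Gamma b * (y powr (- b) * g y)))" for y
  proof (cases "y > 0")
    case True
    have "((\<lambda>s. s powr (b - 1) * exp (- (s * y)) * g y) has_integral Gamma (b / 1) / (1 * y powr (b / 1)) * g y) {0<..}"
      using has_integral_mult_left[OF has_integral_powr_exp_powr[OF b zero_less_one True], of "g y"]
      by (rule has_integral_eq[rotated]) (auto simp: mult_ac)
    from nn_integral_has_integral_lebesgue[OF _ this]
    show ?thesis using True nn[OF True] by (simp add: powr_minus divide_inverse mult_ac)
  qed auto
  have 2: "(\<integral>\<^sup>+y. ?h s y \<partial>lborel) = ennreal (indicator {0<..} s * (s powr (b - d - 1) * exp (- (1 * s powr \<alpha>))))" for s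
  proof (cases "s > 0")
    case True
    have "((\<lambda>y. s powr (b - 1) * exp (- (s * y)) * g y) has_integral s powr (b - 1) * (s powr (- d) * exp (- (s powr \<alpha>)))) {0<..}"
      using has_integral_mult_right[OF lap[OF True], of "s powr (b - 1)"] by (simp add: mult_ac)
    from nn_integral_has_integral_lebesgue[OF _ this]
    have "(\<integral>\<^sup>+y. ?h s y \<partial>lborel) = ennreal (s powr (b - 1) * (s powr (- d) * exp (- (s powr \<alpha>))))"
      using True nn by (simp add: mult_ac)
    also have "s powr (b - 1) * (s powr (- d) * exp (- (s powr \<alpha>))) = s powr (b - d - 1) * exp (- (1 * s powr \<alpha>))"
      by (simp add: powr_add[symmetric] mult.assoc[symmetric] algebra_simps)
    finally show ?thesis using True by simp
  qed auto
  have "(\<integral>\<^sup>+y. ennreal (indicator {0<..} y * (Gamma b * (y powr (- b) * g y))) \<partial>lborel)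
    = (\<integral>\<^sup>+y. (\<integral>\<^sup>+s. ?h s y \<partial>lborel) \<partial>lborel)" by (simp only: 1)
  also have "\<dots> = (\<integral>\<^sup>+s. (\<integral>\<^sup>+y. ?h s y \<partial>lborel) \<partial>lborel)"
    by (rule lborel_pair.Fubini') measurable
  also have "\<dots> = ennreal (Gamma ((b - d) / \<alpha>) / (\<alpha> * 1 powr ((b - d) / \<alpha>)))"
    unfolding 2
    by (rule nn_integral_has_integral_lebesgue[OF _ has_integral_powr_exp_powr]) (use \<alpha> d in auto)
  finally have "((\<lambda>y. Gamma b * (y powr (- b) * g y)) has_integral Gamma ((b - d) / \<alpha>) / \<alpha>) {0<..}"
    using nn Gb \<alpha> d
    by (intro nn_integral_imp_has_integral) (auto intro!: divide_nonneg_nonneg Gamma_real_nonneg)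
  from has_integral_mult_right[OF this, of "1 / Gamma b"] show ?thesis
    using Gb by (simp add: mult_ac)
qed

lemma Prabhakar_mixture:
  fixes g :: "real \<Rightarrow> real"
  assumes g[measurable]: "g \<in> borel_measurable borel" and nn: "\<And>y. y > 0 \<Longrightarrow> 0 \<le> g y"
    and lap: "\<And>s. s > 0 \<Longrightarrow> ((\<lambda>y. exp (- (s * y)) * g y) has_integral s powr (- d) * exp (- (s powr \<alpha>))) {0<..}"
    and \<alpha>: "0 < \<alpha>" "\<alpha> \<le> 1" and d: "0 \<le> d" and c: "0 < c" and b: "b = \<alpha> * c + d"
    and lam: "0 \<le> lam" and x: "0 < x"
  shows "x powr (b - 1) * Prabhakar \<alpha> b c (- lam * x powr \<alpha>) =
    (LINT t:{0<..}|lborel. g (x * t powr (- 1 / \<alpha>)) * t powr ((b - 1) / \<alpha> - 1) * exp (- lam * t)) / Gamma c"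
proof -
  define G where "G = (\<lambda>t. g (x * t powr (- 1 / \<alpha>)) * t powr ((b - 1) / \<alpha> - 1))"
  define M where "M = (\<lambda>k. x powr (\<alpha> * real k + b - 1) * Gamma (c + real k) / Gamma (\<alpha> * real k + b))"
  have bd: "b > d" using b \<alpha> c by simp
  have [measurable]: "G \<in> borel_measurable borel" unfolding G_def by measurable
  have G0: "0 \<le> G t" if "t > 0" for t using nn[of "x * t powr (- 1 / \<alpha>)"] x that by (simp add: G_def)
  have M: "((\<lambda>t. t ^ k * G t) has_integral M k) {0<..}" for k
  proof -
    define B where "B = \<alpha> * real k + b"
    have "B > d" using bd \<alpha> by (simp add: B_def add_nonneg_pos add_strict_increasing2)
    \<comment> \<open>Here the relation \<open>b = \<alpha> * c + d\<close> enters: the moments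
      carry exactly the Gamma values in the numerators of the series.\<close>
    have "(B - d) / \<alpha> = c + real k" using \<alpha> by (simp add: B_def b field_simps)
    with has_integral_negative_moment[OF g nn lap \<alpha>(1) d \<open>B > d\<close>]
    have "((\<lambda>y. y powr (- B) * g y) has_integral Gamma (c + real k) / (\<alpha> * Gamma B)) {0<..}"
      by simp
    from has_integral_powr_substitution[OF _ this x, of "- 1 / \<alpha>"]
    have "((\<lambda>t. x * \<bar>- 1 / \<alpha>\<bar> * t powr (- 1 / \<alpha> - 1) * ((x * t powr (- 1 / \<alpha>)) powr (- B) * g (x * t powr (- 1 / \<alpha>))))
       has_integral Gamma (c + real k) / (\<alpha> * Gamma B)) {0<..}"
      using nn \<alpha> by simp
    from has_integral_mult_right[OF this, of "\<alpha> * x powr (B - 1)"]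
    have "((\<lambda>t. \<alpha> * x powr (B - 1) * (x * \<bar>- 1 / \<alpha>\<bar> * t powr (- 1 / \<alpha> - 1) * ((x * t powr (- 1 / \<alpha>)) powr (- B) * g (x * t powr (- 1 / \<alpha>)))))
       has_integral M k) {0<..}"
      using \<alpha> by (simp add: M_def B_def)
    then show ?thesis
    proof (rule has_integral_eq[rotated])
      fix t :: real assume "t \<in> {0<..}"
      then have t: "t > 0" by simp
      have "t powr (- 1 / \<alpha> - 1) * (t powr (- 1 / \<alpha>)) powr (- B) = t powr (real k + ((b - 1) / \<alpha> - 1))"
      proof -
        have "- 1 / \<alpha> - 1 + - 1 / \<alpha> * - B = real k + ((b - 1) / \<alpha> - 1)"
          using \<alpha> by (simp add: B_def divide_simps)
        then show ?thesis by (simp only: powr_powr powr_add[symmetric])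
      qed
      also have "\<dots> = t ^ k * t powr ((b - 1) / \<alpha> - 1)"
        using t by (simp only: powr_add powr_realpow)
      finally have 1: "t powr (- 1 / \<alpha> - 1) * (t powr (- 1 / \<alpha>)) powr (- B) = t ^ k * t powr ((b - 1) / \<alpha> - 1)" .
      have 2: "x powr (B - 1) * x * x powr (- B) = 1"
        using x by (simp add: powr_diff powr_minus)
      have "\<alpha> * x powr (B - 1) * (x * \<bar>- 1 / \<alpha>\<bar> * t powr (- 1 / \<alpha> - 1) * ((x * t powr (- 1 / \<alpha>)) powr (- B) * g (x * t powr (- 1 / \<alpha>))))
        = (x powr (B - 1) * x * x powr (- B)) * (t powr (- 1 / \<alpha> - 1) * (t powr (- 1 / \<alpha>)) powr (- B)) * g (x * t powr (- 1 / \<alpha>))"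
        using \<alpha> x t by (simp add: powr_mult)
      also have "\<dots> = t ^ k * G t" unfolding 1 2 by (simp add: G_def)
      finally show "\<alpha> * x powr (B - 1) * (x * \<bar>- 1 / \<alpha>\<bar> * t powr (- 1 / \<alpha> - 1) * ((x * t powr (- 1 / \<alpha>)) powr (- B) * g (x * t powr (- 1 / \<alpha>))))
        = t ^ k * G t" .
    qed
  qed
  have MS: "set_integrable lborel {0<..} (\<lambda>t. t ^ k * G t)" "(LINT t:{0<..}|lborel. t ^ k * G t) = M k" for k
    using nonneg_has_integral_imp_set_lborel[OF _ _ _ M, of k] G0
    by (auto simp: set_borel_measurable_def)
  let ?F = "\<lambda>k t. indicator {0<..} t *\<^sub>R ((- lam) ^ k / fact k * (t ^ k * G t))"
  have norm_F: "norm (?F k t) = indicator {0<..} t *\<^sub>R (lam ^ k / fact k * (t ^ k * G t))" for k t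
    using G0[of t] lam by (auto simp: abs_mult indicator_def power_abs)
  have intF: "(LINT t|lborel. indicator {0<..} t *\<^sub>R (r * (t ^ k * G t))) = r * M k" for r k
    using MS(2)[of k] by (simp only: set_lebesgue_integral_def[symmetric] set_integral_mult_right)
  have powr_split: "x powr (\<alpha> * real k + b - 1) = x powr (b - 1) * (x powr \<alpha>) ^ k" for k
  proof -
    have "x powr (\<alpha> * real k + b - 1) = x powr (b - 1) * x powr (\<alpha> * real k)"
      by (simp add: powr_add[symmetric] algebra_simps)
    also have "x powr (\<alpha> * real k) = (x powr \<alpha>) ^ k"
      using x by (simp add: powr_powr[symmetric] powr_realpow)
    finally show ?thesis .
  qed
  \<comment> \<open>Stated for general \<open>r\<close>: \<open>- lam\<close> gives the Prabhakar
    series itself, \<open>lam\<close> the series of absolute values.\<close>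
  have coeff: "r ^ k / fact k * M k = x powr (b - 1) * (Gamma (c + real k) / (fact k * Gamma (\<alpha> * real k + b)) * (r * x powr \<alpha>) ^ k)" for r k
    by (simp add: M_def powr_split power_mult_distrib)
  have "(LINT t:{0<..}|lborel. g (x * t powr (- 1 / \<alpha>)) * t powr ((b - 1) / \<alpha> - 1) * exp (- lam * t))
     = (LINT t|lborel. (\<Sum>k. ?F k t))"
    unfolding set_lebesgue_integral_def
  proof (rule Bochner_Integration.integral_cong[OF refl])
    fix t :: real
    have "(\<lambda>k. (- lam * t) ^ k /\<^sub>R fact k) sums exp (- lam * t)" by (rule exp_converges)
    from sums_mult[OF this, of "indicator {0<..} t * G t"]
    have "(\<lambda>k. ?F k t) sums (indicator {0<..} t * G t * exp (- lam * t))"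
      unfolding power_mult_distrib by (simp add: divide_inverse mult_ac)
    then show "indicator {0<..} t *\<^sub>R (g (x * t powr (- 1 / \<alpha>)) * t powr ((b - 1) / \<alpha> - 1) * exp (- lam * t)) = (\<Sum>k. ?F k t)"
      by (simp add: sums_iff G_def mult_ac)
  qed
  also have "\<dots> = (\<Sum>k. LINT t|lborel. ?F k t)"
  \<comment> \<open>Termwise integration needs the integrals of the absolute values to be summable.
    These form, up to a factor, the series at \<open>lam * x powr \<alpha>\<close>, which
    converges.\<close>
  proof (rule integral_suminf)
    show "integrable lborel (?F k)" for k
      using set_integrable_mult_right[of "(- lam) ^ k / fact k" lborel "{0<..}" "\<lambda>t. t ^ k * G t"] MS(1)[of k]
      unfolding set_integrable_def by simp
    show "AE t in lborel. summable (\<lambda>k. norm (?F k t))"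
    proof (intro AE_I2)
      fix t :: real
      have "summable (\<lambda>k. indicator {0<..} t * G t * ((lam * t) ^ k /\<^sub>R fact k))"
        by (intro summable_mult summable_exp_generic)
      then show "summable (\<lambda>k. norm (?F k t))"
        unfolding norm_F by (simp add: power_mult_distrib divide_inverse mult_ac)
    qed
    have "summable (\<lambda>k. x powr (b - 1) * (Gamma (c + real k) / (fact k * Gamma (\<alpha> * real k + b)) * (lam * x powr \<alpha>) ^ k))"
      by (intro summable_mult summable_Prabhakar) (use \<alpha> bd d c lam in auto)
    then show "summable (\<lambda>k. LINT t|lborel. norm (?F k t))"
      unfolding norm_F intF coeff .
  qed
  also have "\<dots> = x powr (b - 1) * (\<Sum>k. Gamma (c + real k) / (fact k * Gamma (\<alpha> * real k + b)) * (- lam * x powr \<alpha>) ^ k)"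
    unfolding intF coeff
  proof (rule suminf_mult)
    have "summable (\<lambda>k. norm (Gamma (c + real k) / (fact k * Gamma (\<alpha> * real k + b)) * (- lam * x powr \<alpha>) ^ k))"
    proof (rule summable_cong[THEN iffD1, OF _ summable_Prabhakar[of \<alpha> b c "lam * x powr \<alpha>"]])
      show "\<forall>\<^sub>F k in sequentially. Gamma (c + real k) / (fact k * Gamma (\<alpha> * real k + b)) * (lam * x powr \<alpha>) ^ k =
        norm (Gamma (c + real k) / (fact k * Gamma (\<alpha> * real k + b)) * (- lam * x powr \<alpha>) ^ k)"
      proof (intro always_eventually allI)
        fix k :: nat
        have "0 < \<alpha> * real k + b" using \<alpha> bd d by (intro add_nonneg_pos) auto
        then have "0 \<le> Gamma (c + real k) / (fact k * Gamma (\<alpha> * real k + b))"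
          using \<alpha> bd d c by (intro divide_nonneg_nonneg mult_nonneg_nonneg Gamma_real_nonneg) auto
        then show "Gamma (c + real k) / (fact k * Gamma (\<alpha> * real k + b)) * (lam * x powr \<alpha>) ^ k =
          norm (Gamma (c + real k) / (fact k * Gamma (\<alpha> * real k + b)) * (- lam * x powr \<alpha>) ^ k)"
          using lam by (simp only: real_norm_def abs_mult power_abs abs_of_nonneg) (simp add: abs_mult)
      qed
    qed (use \<alpha> bd d c lam in auto)
    then show "summable (\<lambda>k. Gamma (c + real k) / (fact k * Gamma (\<alpha> * real k + b)) * (- lam * x powr \<alpha>) ^ k)"
      by (rule summable_norm_cancel)
  qed
  finally show ?thesis by (simp add: Prabhakar_def)
qed

subsection \<open>Laplace transforms of the mixed functions\<close>

lemma measurable_RL_int: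
  assumes [measurable]: "f \<in> borel_measurable borel"
  shows "RL_int \<nu> f \<in> borel_measurable borel"
proof (cases "\<nu> = 0")
  case True
  then have "RL_int \<nu> f = f" by (simp add: RL_int_def fun_eq_iff)
  then show ?thesis by simp
next
  case False
  \<comment> \<open>Writing the moving interval as a condition on the pair makes the integrand
    jointly measurable.\<close>
  have "(\<lambda>x. LINT u|lborel. (if 0 \<le> u \<and> u \<le> x then (x - u) powr (\<nu> - 1) * f u else 0)) \<in> borel_measurable borel"
    by measurable
  moreover have "RL_int \<nu> f = (\<lambda>x. (LINT u|lborel. (if 0 \<le> u \<and> u \<le> x then (x - u) powr (\<nu> - 1) * f u else 0)) / Gamma \<nu>)"
    using False unfolding RL_int_def set_lebesgue_integral_def
    by (auto simp: fun_eq_iff indicator_def intro!: Bochner_Integration.integral_cong arg_cong2[where f = "(/)"])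
  ultimately show ?thesis by simp
qed

lemma RL_int_nonneg:
  assumes "\<nu> \<ge> 0" "\<And>u. 0 \<le> f u"
  shows "0 \<le> RL_int \<nu> f x"
  unfolding RL_int_def set_lebesgue_integral_def using assms
  by (auto intro!: divide_nonneg_nonneg integral_nonneg_AE Gamma_real_nonneg)

text \<open>Substitution \<open>u \<mapsto> k * u\<close> in the kernel. This moves the scale of the
  stable density into the argument of its fractional integral.\<close>

lemma RL_int_scale:
  assumes k: "k > 0"
  shows "RL_int \<nu> (\<lambda>u. k * f (u * k)) x = k powr (1 - \<nu>) * RL_int \<nu> f (x * k)"
proof (cases "\<nu> = 0")
  case False
  have "(LINT u:{0..x * k}|lborel. (x * k - u) powr (\<nu> - 1) * f u) =
    k * (LINT u|lborel. indicator {0..x * k} (0 + k * u) *\<^sub>R ((x * k - (0 + k * u)) powr (\<nu> - 1) * f (0 + k * u)))"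
    unfolding set_lebesgue_integral_def using k by (subst lborel_integral_real_affine[of k _ 0]) auto
  also have "(LINT u|lborel. indicator {0..x * k} (0 + k * u) *\<^sub>R ((x * k - (0 + k * u)) powr (\<nu> - 1) * f (0 + k * u))) =
    (LINT u|lborel. k powr (\<nu> - 2) * (indicator {0..x} u *\<^sub>R ((x - u) powr (\<nu> - 1) * (k * f (u * k)))))"
  proof (rule Bochner_Integration.integral_cong[OF refl])
    fix u :: real
    show "indicator {0..x * k} (0 + k * u) *\<^sub>R ((x * k - (0 + k * u)) powr (\<nu> - 1) * f (0 + k * u)) =
      k powr (\<nu> - 2) * (indicator {0..x} u *\<^sub>R ((x - u) powr (\<nu> - 1) * (k * f (u * k))))"
    proof (cases "0 \<le> u \<and> u \<le> x")
      case True
      have "x * k - k * u = (x - u) * k" by (simp add: algebra_simps)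
      then have "(x * k - k * u) powr (\<nu> - 1) = (x - u) powr (\<nu> - 1) * k powr (\<nu> - 1)"
        using True k by (simp add: powr_mult)
      also have "k powr (\<nu> - 1) = k powr (\<nu> - 2) * k"
        using k powr_add[of k "\<nu> - 2" 1] by simp
      finally show ?thesis using True k by (simp add: indicator_def mult_ac)
    qed (use k in \<open>auto simp: indicator_def zero_le_mult_iff mult.commute[of x]\<close>)
  qed
  also have "\<dots> = k powr (\<nu> - 2) * (LINT u:{0..x}|lborel. (x - u) powr (\<nu> - 1) * (k * f (u * k)))"
    by (simp add: set_lebesgue_integral_def)
  finally have "(LINT u:{0..x * k}|lborel. (x * k - u) powr (\<nu> - 1) * f u) =
    k powr (\<nu> - 1) * (LINT u:{0..x}|lborel. (x - u) powr (\<nu> - 1) * (k * f (u * k)))"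
    using k powr_add[of k "\<nu> - 2" 1] by (simp add: mult_ac)
  then show ?thesis using k False by (simp add: RL_int_def powr_diff)
qed (use k in \<open>simp add: RL_int_def\<close>)

text \<open>After shifting by \<open>u\<close> this is Euler's integral. It is the kernel transform
  behind the convolution rule, and with \<open>u = 1\<close> it settles the Dirac case.\<close>

lemma nn_integral_shifted_powr_exp:
  assumes s: "s > 0" and d: "d > (0::real)"
  shows "(\<integral>\<^sup>+x. ennreal (indicator {0<..} (x - u) * (exp (- (s * x)) * (x - u) powr (d - 1))) \<partial>lborel) =
    ennreal (Gamma d * s powr (- d) * exp (- (s * u)))"
proof -
  have "((\<lambda>y. exp (- (s * (u + y))) * y powr (d - 1)) has_integral exp (- (s * u)) * (Gamma (d / 1) / (1 * s powr (d / 1)))) {0<..}"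
    using has_integral_mult_right[OF has_integral_powr_exp_powr[OF d zero_less_one s], of "exp (- (s * u))"]
    by (rule has_integral_eq[rotated]) (auto simp: algebra_simps exp_add[symmetric])
  from nn_integral_has_integral_lebesgue[OF _ this]
  have "(\<integral>\<^sup>+y. ennreal (indicator {0<..} y * (exp (- (s * (u + y))) * y powr (d - 1))) \<partial>lborel) =
    ennreal (Gamma d * s powr (- d) * exp (- (s * u)))"
    by (simp add: powr_minus divide_inverse mult_ac)
  moreover have "(\<integral>\<^sup>+x. ennreal (indicator {0<..} (x - u) * (exp (- (s * x)) * (x - u) powr (d - 1))) \<partial>lborel) =
    (\<integral>\<^sup>+y. ennreal (indicator {0<..} y * (exp (- (s * (u + y))) * y powr (d - 1))) \<partial>lborel)"
    by (subst nn_integral_real_affine[of _ 1 u]) auto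
  ultimately show ?thesis by simp
qed

text \<open>The convolution rule: for \<open>d > 0\<close> the fractional integral convolves
  \<open>f\<close> with a power whose transform is \<open>s powr (- d)\<close>, so Tonelli separates
  the factors.\<close>

lemma laplace_RL_int:
  fixes f :: "real \<Rightarrow> real"
  assumes [measurable]: "f \<in> borel_measurable borel" and nn: "\<And>x. 0 \<le> f x" and f0: "f 0 = 0"
    and lap: "\<And>s. s > 0 \<Longrightarrow> ((\<lambda>x. exp (- (s * x)) * f x) has_integral F s) {0<..}"
    and d: "0 \<le> d" and s: "0 < s"
  shows "((\<lambda>x. exp (- (s * x)) * RL_int d f x) has_integral s powr (- d) * F s) {0<..}"
proof (cases "d = 0")
  case True
  then show ?thesis using lap[OF s] s by (simp add: RL_int_def)
next
  case False
  then have d: "d > 0" using d by simp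
  have Gd: "Gamma d > 0" using d by (rule Gamma_real_pos)
  have [measurable]: "RL_int d f \<in> borel_measurable borel" by (rule measurable_RL_int) measurable
  define k where "k = (\<lambda>x u. indicator {0<..} u * (indicator {0<..} (x - u) * ((x - u) powr (d - 1) * f u)))"
  have [measurable]: "case_prod k \<in> borel_measurable (borel \<Otimes>\<^sub>M borel)" unfolding k_def by measurable
  have k0: "0 \<le> k x u" for x u using nn by (simp add: k_def)
  \<comment> \<open>The extended-valued convolution. Its transform at 1 is finite, so
    \<open>N\<close> is finite almost everywhere and agrees there with
    \<open>Gamma d * RL_int d f\<close>; the points where a divergent Bochner integral would default
    to 0 form a null set.\<close>
  define N where "N = (\<lambda>x. \<integral>\<^sup>+u. ennreal (k x u) \<partial>lborel)"
  have [measurable]: "N \<in> borel_measurable borel" unfolding N_def by measurable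
  have F0: "0 \<le> F s" if "s > 0" for s
    by (rule has_integral_nonneg[OF lap[OF that]]) (use nn in auto)
  have N0: "N x = 0" if "x \<le> 0" for x
    using that by (auto simp: N_def k_def indicator_def intro!: nn_integral_zero' AE_I2)
  have N_lap: "(\<integral>\<^sup>+x. ennreal (exp (- (s * x))) * N x \<partial>lborel) = ennreal (Gamma d * s powr (- d) * F s)"
    if s: "s > 0" for s
  proof -
    have "(\<integral>\<^sup>+x. ennreal (exp (- (s * x))) * N x \<partial>lborel) = (\<integral>\<^sup>+x. (\<integral>\<^sup>+u. ennreal (exp (- (s * x)) * k x u) \<partial>lborel) \<partial>lborel)"
      unfolding N_def by (subst nn_integral_cmult[symmetric]) (auto simp: ennreal_mult k0)
    also have "\<dots> = (\<integral>\<^sup>+u. (\<integral>\<^sup>+x. ennreal (exp (- (s * x)) * k x u) \<partial>lborel) \<partial>lborel)"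
      by (rule lborel_pair.Fubini') measurable
    also have "\<dots> = (\<integral>\<^sup>+u. ennreal (Gamma d * s powr (- d)) * ennreal (indicator {0<..} u * (exp (- (s * u)) * f u)) \<partial>lborel)"
    proof (rule nn_integral_cong)
      fix u :: real
      have "(\<integral>\<^sup>+x. ennreal (exp (- (s * x)) * k x u) \<partial>lborel) =
        (\<integral>\<^sup>+x. ennreal (indicator {0<..} u * f u) * ennreal (indicator {0<..} (x - u) * (exp (- (s * x)) * (x - u) powr (d - 1))) \<partial>lborel)"
        using nn by (intro nn_integral_cong) (simp add: k_def ennreal_mult[symmetric] mult_ac)
      also have "\<dots> = ennreal (indicator {0<..} u * f u) * ennreal (Gamma d * s powr (- d) * exp (- (s * u)))"
        by (subst nn_integral_cmult) (auto simp: nn_integral_shifted_powr_exp[OF s d])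
      also have "\<dots> = ennreal (Gamma d * s powr (- d)) * ennreal (indicator {0<..} u * (exp (- (s * u)) * f u))"
        using nn Gd by (simp add: ennreal_mult[symmetric] mult_ac)
      finally show "(\<integral>\<^sup>+x. ennreal (exp (- (s * x)) * k x u) \<partial>lborel) =
        ennreal (Gamma d * s powr (- d)) * ennreal (indicator {0<..} u * (exp (- (s * u)) * f u))" .
    qed
    also have "\<dots> = ennreal (Gamma d * s powr (- d)) * ennreal (F s)"
      using nn_integral_has_integral_lebesgue[OF _ lap[OF s]] nn by (subst nn_integral_cmult) auto
    also have "\<dots> = ennreal (Gamma d * s powr (- d) * F s)"
      using F0[OF s] Gd by (simp add: ennreal_mult)
    finally show ?thesis .
  qed
  have "AE x in lborel. ennreal (exp (- (1 * x))) * N x \<noteq> \<infinity>"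
    by (rule nn_integral_PInf_AE) (use N_lap[of 1] in auto)
  then have AE: "AE x in lborel. ennreal (Gamma d * RL_int d f x) = N x"
  proof eventually_elim
    case (elim x)
    then have fin: "N x \<noteq> \<infinity>" by (auto simp: ennreal_mult_eq_top_iff)
    \<comment> \<open>The kernel \<open>k\<close> leaves out both endpoints: at \<open>u = 0\<close>
      the integrand vanishes by \<open>f0\<close>, at \<open>u = x\<close> because
      \<open>0 powr (d - 1)\<close> is 0.\<close>
    have "(LINT u:{0..x}|lborel. (x - u) powr (d - 1) * f u) = (LINT u|lborel. k x u)"
      unfolding set_lebesgue_integral_def k_def
      by (rule Bochner_Integration.integral_cong) (auto simp: indicator_def f0 not_less less_le)
    also have "\<dots> = enn2real (N x)"
      unfolding N_def by (rule integral_eq_nn_integral) (auto simp: k0)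
    finally show ?case using fin Gd False by (simp add: RL_int_def less_top)
  qed
  have "(\<integral>\<^sup>+x. ennreal (indicator {0<..} x * (Gamma d * (exp (- (s * x)) * RL_int d f x))) \<partial>lborel) =
    (\<integral>\<^sup>+x. ennreal (exp (- (s * x))) * N x \<partial>lborel)"
  proof (rule nn_integral_cong_AE)
    show "AE x in lborel. ennreal (indicator {0<..} x * (Gamma d * (exp (- (s * x)) * RL_int d f x))) = ennreal (exp (- (s * x))) * N x"
      using AE
    proof eventually_elim
      case (elim x)
      have "0 \<le> Gamma d * RL_int d f x" using Gd d nn by (intro mult_nonneg_nonneg RL_int_nonneg) auto
      then show ?case
        using N0[of x] by (cases "x > 0") (auto simp: elim[symmetric] ennreal_mult[symmetric] mult_ac)
    qed
  qed
  also have "\<dots> = ennreal (Gamma d * s powr (- d) * F s)" by (rule N_lap[OF s])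
  finally have "((\<lambda>x. Gamma d * (exp (- (s * x)) * RL_int d f x)) has_integral Gamma d * s powr (- d) * F s) {0<..}"
    using Gd d nn F0[OF s] by (intro nn_integral_imp_has_integral) (auto intro!: mult_nonneg_nonneg RL_int_nonneg)
  from has_integral_mult_right[OF this, of "1 / Gamma d"] show ?thesis
    using Gd by (simp add: mult_ac)
qed

text \<open>Differentiation under the integral sign: the difference quotients along
  \<open>h n\<close> converge by dominated convergence.\<close>

lemma laplace_times_arg:
  fixes f :: "real \<Rightarrow> real"
  assumes [measurable]: "f \<in> borel_measurable borel" and nn: "\<And>x. x > 0 \<Longrightarrow> 0 \<le> f x"
    and lap: "\<And>s. s > 0 \<Longrightarrow> ((\<lambda>x. exp (- (s * x)) * f x) has_integral F s) {0<..}"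
    and s: "0 < s" and D: "(F has_real_derivative - D) (at s)"
  shows "((\<lambda>x. exp (- (s * x)) * (x * f x)) has_integral D) {0<..}"
proof -
  have I: "set_integrable lborel {0<..} (\<lambda>x. exp (- (r * x)) * f x)"
    "(LINT x:{0<..}|lborel. exp (- (r * x)) * f x) = F r" if "r > 0" for r
    using nonneg_has_integral_imp_set_lborel[OF _ _ _ lap[OF that]] nn by (auto simp: set_borel_measurable_def)
  define h where "h = (\<lambda>n. 1 / (real n + 1))"
  have h: "h n > 0" for n by (simp add: h_def)
  have "h \<longlonglongrightarrow> 0" unfolding h_def by real_asymp
  then have h0: "filterlim h (at 0) sequentially"
    using h by (intro filterlim_atI) (auto intro!: always_eventually simp: less_imp_neq[symmetric])
  define S where "S = (\<lambda>n x. indicator {0<..} x *\<^sub>R ((exp (- (s * x)) * f x - exp (- ((s + h n) * x)) * f x) / h n))"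
  define L where "L = (\<lambda>x. indicator {0<..} x *\<^sub>R (exp (- (s * x)) * (x * f x)))"
  have S_eq: "S n x = indicator {0<..} x *\<^sub>R (exp (- (s * x)) * f x) * ((1 - exp (- (h n * x))) / h n)" for n x
    by (simp add: S_def algebra_simps exp_add diff_divide_distrib exp_diff exp_minus divide_inverse)
  \<comment> \<open>The quotient contributes at most a factor \<open>x\<close>, and
    \<open>x \<le> 2 / s * exp (s / 2 * x)\<close> trades it for half of the exponential
    decay.\<close>
  let ?w = "\<lambda>x. indicator {0<..} x *\<^sub>R (2 / s * (exp (- (s / 2 * x)) * f x))"
  have meas: "L \<in> borel_measurable lborel" "\<And>n. S n \<in> borel_measurable lborel"
    unfolding L_def S_def by measurable
  have w: "integrable lborel ?w"
    using set_integrable_mult_right[OF I(1)[of "s / 2"], of "2 / s"] s unfolding set_integrable_def by simp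
  have lim: "AE x in lborel. (\<lambda>n. S n x) \<longlonglongrightarrow> L x"
  proof (rule AE_I2)
    fix x :: real
    have "((\<lambda>h. exp (- (h * x))) has_real_derivative - x) (at 0)"
      by (auto intro!: derivative_eq_intros)
    then have "((\<lambda>h. (exp (- (h * x)) - 1) / h) \<longlongrightarrow> - x) (at 0)"
      by (simp add: DERIV_def)
    from filterlim_compose[OF this h0] have "(\<lambda>n. (exp (- (h n * x)) - 1) / h n) \<longlonglongrightarrow> - x" .
    from tendsto_mult_left[OF tendsto_minus[OF this], of "indicator {0<..} x *\<^sub>R (exp (- (s * x)) * f x)"]
    show "(\<lambda>n. S n x) \<longlonglongrightarrow> L x"
      unfolding S_eq L_def by (simp add: minus_divide_left mult_ac)
  qed
  have bound: "AE x in lborel. norm (S n x) \<le> ?w x" for n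
  proof (rule AE_I2)
    fix x :: real
    show "norm (S n x) \<le> ?w x"
    proof (cases "x > 0")
      case True
      have "1 - exp (- (h n * x)) \<le> h n * x" using exp_ge_add_one_self[of "- (h n * x)"] by simp
      then have 1: "(1 - exp (- (h n * x))) / h n \<le> x" using h[of n] by (simp add: field_simps)
      have 0: "0 \<le> (1 - exp (- (h n * x))) / h n" using h[of n] True by simp
      have "s / 2 * x \<le> exp (s / 2 * x)" using exp_ge_add_one_self[of "s / 2 * x"] by linarith
      then have "exp (- (s * x)) * x \<le> exp (- (s * x)) * (2 / s * exp (s / 2 * x))"
        using s by (intro mult_left_mono) (auto simp: field_simps)
      also have "\<dots> = 2 / s * exp (- (s / 2 * x))"
        by (simp add: exp_add[symmetric])
      finally have "exp (- (s * x)) * x \<le> 2 / s * exp (- (s / 2 * x))" .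
      then have 2: "exp (- (s * x)) * x * f x \<le> 2 / s * exp (- (s / 2 * x)) * f x"
        using nn[OF True] by (intro mult_right_mono)
      have "exp (- (s * x)) * f x * ((1 - exp (- (h n * x))) / h n) \<le> exp (- (s * x)) * f x * x"
        using 1 nn[OF True] by (intro mult_left_mono) auto
      moreover have "0 \<le> exp (- (s * x)) * f x * ((1 - exp (- (h n * x))) / h n)"
        using 0 nn[OF True] by (intro mult_nonneg_nonneg) auto
      ultimately show ?thesis unfolding S_eq using 2 True by (simp add: mult_ac)
    qed (simp add: S_def)
  qed
  have intL: "integrable lborel L"
    by (rule integrable_dominated_convergence[OF meas w lim bound])
  have "(\<lambda>n. integral\<^sup>L lborel (S n)) \<longlonglongrightarrow> integral\<^sup>L lborel L"
    by (rule integral_dominated_convergence[OF meas w lim bound])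
  moreover have "integral\<^sup>L lborel (S n) = (F s - F (s + h n)) / h n" for n
  proof -
    have "integral\<^sup>L lborel (S n) = (LINT x:{0<..}|lborel. (exp (- (s * x)) * f x - exp (- ((s + h n) * x)) * f x) / h n)"
      by (simp add: S_def set_lebesgue_integral_def)
    also have "\<dots> = (F s - F (s + h n)) / h n"
      using h[of n] s by (simp add: set_integral_diff I)
    finally show ?thesis .
  qed
  moreover have "(\<lambda>n. (F s - F (s + h n)) / h n) \<longlonglongrightarrow> D"
  proof -
    have "((\<lambda>h. (F (s + h) - F s) / h) \<longlongrightarrow> - D) (at 0)" using D by (simp add: DERIV_def)
    from filterlim_compose[OF this h0] have "(\<lambda>n. (F (s + h n) - F s) / h n) \<longlonglongrightarrow> - D" .
    from tendsto_minus[OF this] show ?thesis by (simp add: minus_divide_left)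
  qed
  ultimately have "integral\<^sup>L lborel L = D" by (simp add: LIMSEQ_unique)
  moreover have "set_integrable lborel {0<..} (\<lambda>x. exp (- (s * x)) * (x * f x))"
    using intL unfolding set_integrable_def L_def .
  ultimately show ?thesis
    using set_lborel_imp_has_integral by (fastforce simp: L_def set_lebesgue_integral_def)
qed

section \<open>Dirac measures and the case \<open>\<alpha> = 1\<close>\<close>

lemma laplace_RL_meas_return:
  fixes d s :: real
  assumes d: "0 < d" and s: "0 < s"
  shows "((\<lambda>y. exp (- (s * y)) * (indicator {..<y} 1 * (y - 1) powr (d - 1) / Gamma d)) has_integral
    s powr (- d) * exp (- s)) {0<..}"
proof -
  have Gd: "Gamma d > 0" using d by (rule Gamma_real_pos)
  have "(\<integral>\<^sup>+y. ennreal (indicator {0<..} y * (exp (- (s * y)) * (indicator {..<y} 1 * (y - 1) powr (d - 1)))) \<partial>lborel) =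
    (\<integral>\<^sup>+y. ennreal (indicator {0<..} (y - 1) * (exp (- (s * y)) * (y - 1) powr (d - 1))) \<partial>lborel)"
    by (intro nn_integral_cong) (auto simp: indicator_def)
  also have "\<dots> = ennreal (Gamma d * s powr (- d) * exp (- (s * 1)))"
    by (rule nn_integral_shifted_powr_exp[OF s d])
  finally have *: "(\<integral>\<^sup>+y. ennreal (indicator {0<..} y * (exp (- (s * y)) * (indicator {..<y} 1 * (y - 1) powr (d - 1)))) \<partial>lborel) =
    ennreal (Gamma d * s powr (- d) * exp (- (s * 1)))" .
  have "((\<lambda>y. exp (- (s * y)) * (indicator {..<y} 1 * (y - 1) powr (d - 1))) has_integral
      Gamma d * s powr (- d) * exp (- (s * 1))) {0<..}"
  proof (rule nn_integral_imp_has_integral[OF _ _ _ *])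
    have "(\<lambda>y::real. exp (- (s * y)) * ((if 1 < y then 1 else 0) * (y - 1) powr (d - 1))) \<in> borel_measurable borel"
      by measurable
    then show "(\<lambda>y::real. exp (- (s * y)) * (indicator {..<y} 1 * (y - 1) powr (d - 1))) \<in> borel_measurable borel"
      by (simp add: indicator_def of_bool_def)
  qed (use Gd in auto)
  from has_integral_mult_right[OF this, of "1 / Gamma d"] show ?thesis
    using Gd by (simp add: mult_ac)
qed

lemma RL_meas_return: "RL_meas \<nu> (return borel t) x = indicator {..<x} t * (x - t) powr (\<nu> - 1) / Gamma \<nu>"
  unfolding RL_meas_def by (subst integral_return) auto

lemma Prabhakar_1_eq_exp:
  assumes "0 < c" shows "Prabhakar 1 c c z = exp z / Gamma c"
proof -
  have "Gamma (c + real k) / (fact k * Gamma (1 * real k + c)) * z ^ k = z ^ k /\<^sub>R fact k" for k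
  proof -
    have "Gamma (c + real k) > 0" using assms by (intro Gamma_real_pos add_pos_nonneg) auto
    then show ?thesis by (simp add: add.commute divide_inverse)
  qed
  then show ?thesis by (simp add: Prabhakar_def exp_def)
qed

text \<open>For \<open>\<alpha> < 1\<close> the identities are pointwise. For
  \<open>\<alpha> = 1\<close> and positive order, the fractional integral of a Dirac measure is
  still a function, so they remain pointwise. At order zero the Dirac measure itself is mixed, and
  both sides are compared through test functions.\<close>

theorem theorem1:
  fixes \<alpha> \<beta> \<gamma> \<theta> lam :: real
  assumes "0 < \<alpha>" and "\<alpha> \<le> 1" and "0 < \<gamma>" and "\<alpha> * \<gamma> \<le> \<beta>"
    and "- (\<alpha> * \<gamma>) < \<theta>" and "0 \<le> lam"
  shows
   "(\<alpha> < 1 \<longrightarrow> (\<forall>x>0.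
       x powr (\<beta> + \<theta> - 1) * Prabhakar \<alpha> (\<beta> + \<theta>) (\<gamma> + \<theta> / \<alpha>) (- lam * x powr \<alpha>)
         = (LINT t:{0<..}|lborel. RL_int (\<beta> - \<alpha> * \<gamma>) (stable_pdf \<alpha> t) x
              * t powr (\<gamma> + \<theta> / \<alpha> - 1) * exp (- lam * t)) / Gamma (\<gamma> + \<theta> / \<alpha>)
       \<and> x powr (\<beta> + \<theta> - 1) * Prabhakar \<alpha> (\<beta> + \<theta>) (\<gamma> + \<theta> / \<alpha>) (- lam * x powr \<alpha>)
         = (LINT t:{0<..}|lborel. RL_int (\<beta> - \<alpha> * \<gamma>) (stable_pdf \<alpha> 1) (x * t powr (- 1 / \<alpha>))
              * t powr ((\<beta> + \<theta> - 1) / \<alpha> - 1) * exp (- lam * t)) / Gamma (\<gamma> + \<theta> / \<alpha>)))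
  \<and> (\<alpha> = 1 \<and> 0 < \<beta> - \<alpha> * \<gamma> \<longrightarrow> (\<forall>x>0.
       x powr (\<beta> + \<theta> - 1) * Prabhakar \<alpha> (\<beta> + \<theta>) (\<gamma> + \<theta> / \<alpha>) (- lam * x powr \<alpha>)
         = (LINT t:{0<..}|lborel. RL_meas (\<beta> - \<alpha> * \<gamma>) (stable_measure \<alpha> t) x
              * t powr (\<gamma> + \<theta> / \<alpha> - 1) * exp (- lam * t)) / Gamma (\<gamma> + \<theta> / \<alpha>)
       \<and> x powr (\<beta> + \<theta> - 1) * Prabhakar \<alpha> (\<beta> + \<theta>) (\<gamma> + \<theta> / \<alpha>) (- lam * x powr \<alpha>)
         = (LINT t:{0<..}|lborel. RL_meas (\<beta> - \<alpha> * \<gamma>) (stable_measure \<alpha> 1) (x * t powr (- 1 / \<alpha>))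
              * t powr ((\<beta> + \<theta> - 1) / \<alpha> - 1) * exp (- lam * t)) / Gamma (\<gamma> + \<theta> / \<alpha>)))
  \<and> (\<alpha> < 1 \<and> \<beta> - \<alpha> * \<gamma> = 0 \<longrightarrow> (\<forall>x>0.
       x powr (\<beta> + \<theta> - 1) * Prabhakar \<alpha> (\<beta> + \<theta>) (\<gamma> + \<theta> / \<alpha>) (- lam * x powr \<alpha>)
         = (LINT t:{0<..}|lborel. stable_pdf \<alpha> 1 (x * t powr (- 1 / \<alpha>))
              * t powr ((\<beta> + \<theta> - 1) / \<alpha> - 1) * exp (- lam * t)) / Gamma (\<gamma> + \<theta> / \<alpha>)))
  \<and> (\<alpha> < 1 \<and> \<beta> - \<alpha> * \<gamma> = 1 - \<alpha> \<longrightarrow> (\<forall>x>0.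
       x powr (\<beta> + \<theta> - 1) * Prabhakar \<alpha> (\<beta> + \<theta>) (\<gamma> + \<theta> / \<alpha>) (- lam * x powr \<alpha>)
         = 1 / Gamma (\<gamma> + \<theta> / \<alpha>) * (x / \<alpha>) *
           (LINT t:{0<..}|lborel. stable_pdf \<alpha> 1 (x * t powr (- 1 / \<alpha>))
              * t powr ((\<beta> + \<theta> - 2) / \<alpha> - 1) * exp (- lam * t))))
  \<and> (\<alpha> = 1 \<and> \<beta> - \<alpha> * \<gamma> = 0 \<longrightarrow> (\<forall>\<phi>. test_fun \<phi> \<longrightarrow>
       (LINT x:{0<..}|lborel. \<phi> x *
          (x powr (\<beta> + \<theta> - 1) * Prabhakar \<alpha> (\<beta> + \<theta>) (\<gamma> + \<theta> / \<alpha>) (- lam * x powr \<alpha>)))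
         = (LINT t:{0<..}|lborel. (\<integral>y. \<phi> y \<partial>stable_measure \<alpha> t)
              * t powr (\<gamma> + \<theta> / \<alpha> - 1) * exp (- lam * t)) / Gamma (\<gamma> + \<theta> / \<alpha>)
     \<and> (LINT x:{0<..}|lborel. \<phi> x *
          (x powr (\<beta> + \<theta> - 1) * Prabhakar \<alpha> (\<beta> + \<theta>) (\<gamma> + \<theta> / \<alpha>) (- lam * x powr \<alpha>)))
         = (LINT t:{0<..}|lborel. t powr (1 / \<alpha>) *
              (\<integral>y. \<phi> (y * t powr (1 / \<alpha>)) \<partial>stable_measure \<alpha> 1)
              * t powr ((\<beta> + \<theta> - 1) / \<alpha> - 1) * exp (- lam * t)) / Gamma (\<gamma> + \<theta> / \<alpha>)
     \<and> (LINT x:{0<..}|lborel. \<phi> x *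
          (x powr (\<beta> + \<theta> - 1) * Prabhakar \<alpha> (\<beta> + \<theta>) (\<gamma> + \<theta> / \<alpha>) (- lam * x powr \<alpha>)))
         = 1 / Gamma (\<gamma> + \<theta> / \<alpha>) *
           (LINT t:{0<..}|lborel. t powr (1 / \<alpha>) *
              (\<integral>y. (y * t powr (1 / \<alpha>)) / \<alpha> * \<phi> (y * t powr (1 / \<alpha>)) \<partial>stable_measure \<alpha> 1)
              * t powr ((\<beta> + \<theta> - 2) / \<alpha> - 1) * exp (- lam * t))))"
proof -
  define c b d where "c = \<gamma> + \<theta> / \<alpha>" and "b = \<beta> + \<theta>" and "d = \<beta> - \<alpha> * \<gamma>"
  note \<alpha> = assms(1,2) and lam = assms(6)
  have d: "0 \<le> d" using assms(4) by (simp add: d_def)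
  have b: "b = \<alpha> * c + d" using \<alpha> by (simp add: b_def c_def d_def algebra_simps)
  have c: "0 < c"
  proof -
    have "0 < \<alpha> * c" using assms(1,5) by (simp add: c_def algebra_simps)
    then show ?thesis using assms(1) by (simp add: zero_less_mult_iff)
  qed
  let ?P = "\<lambda>x. x powr (b - 1) * Prabhakar \<alpha> b c (- lam * x powr \<alpha>)"

  \<comment> \<open>The mixture lemma with \<open>g\<close> the fractional integral of the density
    of scale 1, whose transform has the factor \<open>s powr (- d)\<close>.\<close>
  have second: "?P x = (LINT t:{0<..}|lborel. RL_int d (stable_pdf \<alpha> 1) (x * t powr (- 1 / \<alpha>))
      * t powr ((b - 1) / \<alpha> - 1) * exp (- lam * t)) / Gamma c" if "\<alpha> < 1" "x > 0" for x
  proof (rule Prabhakar_mixture[OF _ _ _ \<alpha> d c b lam \<open>x > 0\<close>])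
    note A = assms(1) \<open>\<alpha> < 1\<close>
    have nn: "0 \<le> stable_pdf \<alpha> 1 y" for y by (rule stable_pdf_nonneg[OF A]) simp
    show "RL_int d (stable_pdf \<alpha> 1) \<in> borel_measurable borel"
      by (intro measurable_RL_int measurable_stable_pdf[OF A]) simp
    show "0 \<le> RL_int d (stable_pdf \<alpha> 1) y" for y by (intro RL_int_nonneg d nn)
    show "((\<lambda>y. exp (- (s * y)) * RL_int d (stable_pdf \<alpha> 1) y) has_integral s powr (- d) * exp (- (s powr \<alpha>))) {0<..}"
      if "s > 0" for s
      using is_stable_pdf_laplace(1)[OF is_stable_pdf_stable_pdf[OF A zero_less_one]] that nn d
      by (intro laplace_RL_int measurable_stable_pdf[OF A]) (auto simp: stable_pdf_eq_0[OF A])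
  qed

  \<comment> \<open>Scaling the density and its fractional integral produces a power of
    \<open>t\<close> that turns the exponent \<open>c - 1\<close> into
    \<open>(b - 1) / \<alpha> - 1\<close>.\<close>
  have first: "?P x = (LINT t:{0<..}|lborel. RL_int d (stable_pdf \<alpha> t) x
      * t powr (c - 1) * exp (- lam * t)) / Gamma c" if "\<alpha> < 1" "x > 0" for x
    unfolding second[OF that]
  proof (intro arg_cong2[where f = "(/)"] set_lebesgue_integral_cong allI impI refl)
    fix t :: real assume "t \<in> {0<..}"
    then have t: "t > 0" by simp
    have "stable_pdf \<alpha> t = (\<lambda>u. t powr (- 1 / \<alpha>) * stable_pdf \<alpha> 1 (u * t powr (- 1 / \<alpha>)))"
      using stable_pdf_scale[OF assms(1) \<open>\<alpha> < 1\<close> t] by (simp add: fun_eq_iff)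
    then have "RL_int d (stable_pdf \<alpha> t) x =
        (t powr (- 1 / \<alpha>)) powr (1 - d) * RL_int d (stable_pdf \<alpha> 1) (x * t powr (- 1 / \<alpha>))"
      using RL_int_scale[of "t powr (- 1 / \<alpha>)"] t by simp
    moreover have "(t powr (- 1 / \<alpha>)) powr (1 - d) * t powr (c - 1) = t powr ((b - 1) / \<alpha> - 1)"
    proof -
      have "- 1 / \<alpha> * (1 - d) + (c - 1) = (b - 1) / \<alpha> - 1" using assms(1) by (simp add: b field_simps)
      then show ?thesis by (simp only: powr_powr powr_add[symmetric])
    qed
    ultimately show "RL_int d (stable_pdf \<alpha> 1) (x * t powr (- 1 / \<alpha>)) * t powr ((b - 1) / \<alpha> - 1) * exp (- lam * t) =
      RL_int d (stable_pdf \<alpha> t) x * t powr (c - 1) * exp (- lam * t)"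
      by (simp add: mult_ac)
  qed simp

  \<comment> \<open>Here \<open>g\<close> is the shifted power obtained by fractional integration of
    the unit mass at 1.\<close>
  have dirac2: "?P x = (LINT t:{0<..}|lborel. RL_meas d (stable_measure \<alpha> 1) (x * t powr (- 1 / \<alpha>))
      * t powr ((b - 1) / \<alpha> - 1) * exp (- lam * t)) / Gamma c" if "\<alpha> = 1" "d > 0" "x > 0" for x
  proof (rule Prabhakar_mixture[OF _ _ _ \<alpha> d c b lam \<open>x > 0\<close>])
    have eq: "RL_meas d (stable_measure \<alpha> 1) y = indicator {..<y} 1 * (y - 1) powr (d - 1) / Gamma d" for y
      using \<open>\<alpha> = 1\<close> by (simp add: stable_measure_def RL_meas_return)
    have "(\<lambda>y::real. (if 1 < y then 1 else 0) * (y - 1) powr (d - 1) / Gamma d) \<in> borel_measurable borel"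
      by measurable
    then show "RL_meas d (stable_measure \<alpha> 1) \<in> borel_measurable borel"
      unfolding eq[abs_def] by (simp add: indicator_def of_bool_def)
    show "0 \<le> RL_meas d (stable_measure \<alpha> 1) y" for y
      unfolding eq using Gamma_real_pos[OF \<open>d > 0\<close>] by auto
    show "((\<lambda>y. exp (- (s * y)) * RL_meas d (stable_measure \<alpha> 1) y) has_integral s powr (- d) * exp (- (s powr \<alpha>))) {0<..}"
      if "s > 0" for s
      using laplace_RL_meas_return[OF \<open>d > 0\<close> that] that \<open>\<alpha> = 1\<close> unfolding eq by simp
  qed

  have dirac1: "?P x = (LINT t:{0<..}|lborel. RL_meas d (stable_measure \<alpha> t) x
      * t powr (c - 1) * exp (- lam * t)) / Gamma c" if "\<alpha> = 1" "d > 0" "x > 0" for x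
    unfolding dirac2[OF that]
  proof (intro arg_cong2[where f = "(/)"] set_lebesgue_integral_cong allI impI refl)
    fix t :: real assume "t \<in> {0<..}"
    then have t: "t > 0" by simp
    have tinv: "t powr (- 1 / \<alpha>) = 1 / t" using t \<open>\<alpha> = 1\<close> by (simp add: powr_minus divide_inverse)
    have "(x / t - 1) powr (d - 1) * t powr ((b - 1) / \<alpha> - 1) = (x - t) powr (d - 1) * t powr (c - 1)" if "t < x"
    proof -
      have "x / t - 1 = (x - t) / t" using t by (simp add: field_simps)
      then have "(x / t - 1) powr (d - 1) = (x - t) powr (d - 1) * t powr (1 - d)"
        using t that by (simp add: powr_divide powr_diff)
      moreover have "t powr (1 - d) * t powr ((b - 1) / \<alpha> - 1) = t powr (c - 1)"
        using \<open>\<alpha> = 1\<close> by (simp add: powr_add[symmetric] b)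
      ultimately show ?thesis by (simp add: mult_ac)
    qed
    then show "RL_meas d (stable_measure \<alpha> 1) (x * t powr (- 1 / \<alpha>)) * t powr ((b - 1) / \<alpha> - 1) * exp (- lam * t) =
      RL_meas d (stable_measure \<alpha> t) x * t powr (c - 1) * exp (- lam * t)"
      using t \<open>\<alpha> = 1\<close> unfolding tinv stable_measure_def
      by (auto simp: RL_meas_return indicator_def field_simps)
  qed simp

  have case0: "?P x = (LINT t:{0<..}|lborel. stable_pdf \<alpha> 1 (x * t powr (- 1 / \<alpha>))
      * t powr ((b - 1) / \<alpha> - 1) * exp (- lam * t)) / Gamma c" if "\<alpha> < 1" "d = 0" "x > 0" for x
    using second[OF that(1,3)] that(2) by (simp add: RL_int_def)

  \<comment> \<open>Now \<open>g y = y * f y / \<alpha>\<close> with \<open>f\<close> the stable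
    density: multiplication by \<open>y\<close> differentiates the transform, giving the factor
    \<open>s powr (\<alpha> - 1)\<close>, which is \<open>s powr (- d)\<close> here.\<close>
  have case1: "?P x = 1 / Gamma c * (x / \<alpha>) * (LINT t:{0<..}|lborel. stable_pdf \<alpha> 1 (x * t powr (- 1 / \<alpha>))
      * t powr ((b - 2) / \<alpha> - 1) * exp (- lam * t))" if "\<alpha> < 1" "d = 1 - \<alpha>" "x > 0" for x
  proof -
    note A = assms(1) \<open>\<alpha> < 1\<close>
    let ?g = "\<lambda>y. y * stable_pdf \<alpha> 1 y / \<alpha>"
    have nn: "0 \<le> stable_pdf \<alpha> 1 y" for y by (rule stable_pdf_nonneg[OF A]) simp
    have m: "stable_pdf \<alpha> 1 \<in> borel_measurable borel" by (rule measurable_stable_pdf[OF A]) simp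
    have "?P x = (LINT t:{0<..}|lborel. ?g (x * t powr (- 1 / \<alpha>)) * t powr ((b - 1) / \<alpha> - 1) * exp (- lam * t)) / Gamma c"
    proof (rule Prabhakar_mixture[OF _ _ _ \<alpha> d c b lam \<open>x > 0\<close>])
      show "?g \<in> borel_measurable borel" using m by measurable
      show "0 \<le> ?g y" if "y > 0" for y using that nn[of y] assms(1) by simp
      show "((\<lambda>y. exp (- (s * y)) * ?g y) has_integral s powr (- d) * exp (- (s powr \<alpha>))) {0<..}" if s: "s > 0" for s
      proof -
        have "((\<lambda>s. exp (- (1 * s powr \<alpha>))) has_real_derivative - (\<alpha> * s powr (\<alpha> - 1) * exp (- (s powr \<alpha>)))) (at s)"
          using s by (auto intro!: derivative_eq_intros simp: powr_diff)
        from laplace_times_arg[OF m nn is_stable_pdf_laplace(1)[OF is_stable_pdf_stable_pdf[OF A zero_less_one]] s this]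
        have "((\<lambda>y. exp (- (s * y)) * (y * stable_pdf \<alpha> 1 y)) has_integral \<alpha> * s powr (\<alpha> - 1) * exp (- (s powr \<alpha>))) {0<..}" .
        from has_integral_mult_right[OF this, of "1 / \<alpha>"] show ?thesis
          using assms(1) that(1) \<open>d = 1 - \<alpha>\<close> by simp
      qed
    qed
    also have "(LINT t:{0<..}|lborel. ?g (x * t powr (- 1 / \<alpha>)) * t powr ((b - 1) / \<alpha> - 1) * exp (- lam * t)) =
      (LINT t:{0<..}|lborel. x / \<alpha> * (stable_pdf \<alpha> 1 (x * t powr (- 1 / \<alpha>)) * t powr ((b - 2) / \<alpha> - 1) * exp (- lam * t)))"
    proof (intro set_lebesgue_integral_cong allI impI)
      fix t :: real
      have "- 1 / \<alpha> + ((b - 1) / \<alpha> - 1) = (b - 2) / \<alpha> - 1" by (simp add: diff_divide_distrib)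
      then have eq: "t powr (- 1 / \<alpha>) * t powr ((b - 1) / \<alpha> - 1) = t powr ((b - 2) / \<alpha> - 1)"
        by (simp only: powr_add[symmetric])
      then show "?g (x * t powr (- 1 / \<alpha>)) * t powr ((b - 1) / \<alpha> - 1) * exp (- lam * t) =
        x / \<alpha> * (stable_pdf \<alpha> 1 (x * t powr (- 1 / \<alpha>)) * t powr ((b - 2) / \<alpha> - 1) * exp (- lam * t))"
        unfolding eq[symmetric] by (simp add: mult_ac)
    qed simp
    finally show ?thesis by simp
  qed

  \<comment> \<open>With \<open>\<alpha> = 1\<close> and \<open>d = 0\<close> also
    \<open>b = c\<close>, so the Prabhakar function is an exponential. Integrals against the Dirac
    measures are point evaluations, and all right-hand sides reduce to the integral in
    \<open>*\<close>. The factor \<open>t powr (1 / \<alpha>)\<close> is the Jacobian of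
    \<open>x = y * t powr (1 / \<alpha>)\<close>.\<close>
  have dirac0:
    "(LINT x:{0<..}|lborel. \<phi> x * ?P x) =
       (LINT t:{0<..}|lborel. (\<integral>y. \<phi> y \<partial>stable_measure \<alpha> t) * t powr (c - 1) * exp (- lam * t)) / Gamma c"
    "(LINT x:{0<..}|lborel. \<phi> x * ?P x) =
       (LINT t:{0<..}|lborel. t powr (1 / \<alpha>) * (\<integral>y. \<phi> (y * t powr (1 / \<alpha>)) \<partial>stable_measure \<alpha> 1)
          * t powr ((b - 1) / \<alpha> - 1) * exp (- lam * t)) / Gamma c"
    "(LINT x:{0<..}|lborel. \<phi> x * ?P x) =
       1 / Gamma c * (LINT t:{0<..}|lborel. t powr (1 / \<alpha>) *
          (\<integral>y. (y * t powr (1 / \<alpha>)) / \<alpha> * \<phi> (y * t powr (1 / \<alpha>)) \<partial>stable_measure \<alpha> 1)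
          * t powr ((b - 2) / \<alpha> - 1) * exp (- lam * t))"
    if "\<alpha> = 1" "d = 0" "test_fun \<phi>" for \<phi>
  proof -
    have [simp]: "b = c" using b that by simp
    have [measurable]: "\<phi> \<in> borel_measurable borel"
      using \<open>test_fun \<phi>\<close> by (auto simp: test_fun_def intro: borel_measurable_continuous_onI)
    have ret: "(\<integral>y. f y \<partial>stable_measure \<alpha> t) = f t" if "f \<in> borel_measurable borel" for f :: "real \<Rightarrow> real" and t
      using that \<open>\<alpha> = 1\<close> by (simp add: stable_measure_def integral_return)
    note ret1 = ret[unfolded \<open>\<alpha> = 1\<close>]
    have "(LINT x:{0<..}|lborel. \<phi> x * ?P x) =
        (LINT x:{0<..}|lborel. (\<phi> x * x powr (c - 1) * exp (- lam * x)) / Gamma c)"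
      using \<open>\<alpha> = 1\<close> by (intro set_lebesgue_integral_cong) (auto simp: Prabhakar_1_eq_exp[OF c])
    then have *: "(LINT x:{0<..}|lborel. \<phi> x * ?P x) =
        (LINT x:{0<..}|lborel. \<phi> x * x powr (c - 1) * exp (- lam * x)) / Gamma c"
      by simp
    show "(LINT x:{0<..}|lborel. \<phi> x * ?P x) =
       (LINT t:{0<..}|lborel. (\<integral>y. \<phi> y \<partial>stable_measure \<alpha> t) * t powr (c - 1) * exp (- lam * t)) / Gamma c"
      unfolding * by (simp add: ret)
    \<comment> \<open>The exponents in the second and third identity become \<open>c - 2\<close> and
      \<open>c - 3\<close>. The Jacobian \<open>t\<close>, and in the third case also the factor
      \<open>y * t\<close> at \<open>y = 1\<close>, restore \<open>c - 1\<close>.\<close>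
    have 1: "t * t powr (c - 2) = t powr (c - 1)" if "t > 0" for t
      using powr_add[of t 1 "c - 2"] that by simp
    have 2: "t * (t * t powr (c - 3)) = t powr (c - 1)" if "t > 0" for t
      using powr_add[of t 2 "c - 3"] that by (simp add: power2_eq_square mult.assoc)
    show "(LINT x:{0<..}|lborel. \<phi> x * ?P x) =
       (LINT t:{0<..}|lborel. t powr (1 / \<alpha>) * (\<integral>y. \<phi> (y * t powr (1 / \<alpha>)) \<partial>stable_measure \<alpha> 1)
          * t powr ((b - 1) / \<alpha> - 1) * exp (- lam * t)) / Gamma c"
      unfolding * using \<open>\<alpha> = 1\<close>
      by (intro arg_cong2[where f = "(/)"] set_lebesgue_integral_cong) (auto simp: ret1 1[symmetric])
    show "(LINT x:{0<..}|lborel. \<phi> x * ?P x) =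
       1 / Gamma c * (LINT t:{0<..}|lborel. t powr (1 / \<alpha>) *
          (\<integral>y. (y * t powr (1 / \<alpha>)) / \<alpha> * \<phi> (y * t powr (1 / \<alpha>)) \<partial>stable_measure \<alpha> 1)
          * t powr ((b - 2) / \<alpha> - 1) * exp (- lam * t))"
      unfolding * divide_inverse[of _ "Gamma c"] mult_1_left mult.commute[of _ "inverse (Gamma c)"] using \<open>\<alpha> = 1\<close>
      by (intro arg_cong2[where f = "(*)"] set_lebesgue_integral_cong) (auto simp: ret1 2[symmetric])
  qed

  show ?thesis
    unfolding b_def[symmetric] c_def[symmetric] d_def[symmetric]
    using first second dirac1 dirac2 case0 case1 dirac0 by blast
qed

end
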